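(* Let $M\in M_n(\mathbb R)$ be LCP-generic and such that $1\notin\mathrm{Spec}^a_L(M)$. If $c^a_L(M)$ is even, then $M$ is a $Q$-matrix, i.e., for all $q\in\mathbb R^n$, $\operatorname{LCP}(q,M)$ has a solution.
   Context: For $q\in\mathbb R^n$ and a real $n\times n$ matrix $M\in M_n(\mathbb R)$, the linear complementarity problem $\operatorname{LCP}(q,M)$ is to find $v,w\in\mathbb R^n_{\ge0}$ with $v^Tw=0$ and $v=Mw+q$. $\mathbb I$ is the identity matrix and $\mathcal S_n$ is the set of diagonal $n\times n$ matrices with all diagonal entries in $\{-1,+1\}$. An LCP-aligned trio of $M$ is a triple $(\lambda,S,v)$ with $\lambda\ge0$ real, $S\in\mathcal S_n$, $v\in\mathbb R^n_{\ge0}$, $\|v\|_2=1$, and $(M-\mathbb I)v=\lambda(M+\mathbb I)Sv$. Then $\lambda$ is an LCP-aligned value of $M$, and $\mathrm{Spec}^a_L(M)$ is the set of LCP-aligned values of $M$. The multiplicity of an LCP-aligned value $\lambda$ of an LCP-generic $M$ is the number of pairs $(S,v)$ such that $(\lambda,S,v)$ is an LCP-aligned trio of $M$. $c^a_L(M)$ is the number of LCP-aligned values of $M$ greater than one, counted with multiplicity. A matrix $A\in M_n(\mathbb R)$ is generic if for every triple $(\lambda,S,v)$ with $\lambda\ge 0$, $S\in\mathcal S_n$, $v\in\mathbb R^n_{\ge 0}$, $\|v\|_2=1$ and $SAv=\lambda v$, $\lambda$ is a simple eigenvalue of $SA$ and $v$ is strictly positive. $M$ is LCP-generic if $M+\mathbb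 I$ is invertible and $(M+\mathbb I)^{-1}(M-\mathbb I)$ is generic. *)

theory Defs
  imports "HOL-Analysis.Analysis" "HOL-Computational_Algebra.Polynomial"
begin

text \<open>
  Componentwise (strict) nonnegativity is spelled out by coordinates throughout, because the
  order on \<^typ>\<open>real ^ 'n\<close> has \<open>0 < v\<close> meaning \<open>0 \<le> v \<and> v \<noteq> 0\<close>.
\<close>

subsection \<open>Linear complementarity problems\<close>

definition LCP_solution ::
    "real ^ 'n \<Rightarrow> real ^ 'n ^ 'n \<Rightarrow> real ^ 'n \<Rightarrow> real ^ 'n \<Rightarrow> bool" where
  "LCP_solution q M v w \<longleftrightarrow>
     (\<forall>i. 0 \<le> v $ i) \<and> (\<forall>i. 0 \<le> w $ i) \<and> v \<bullet> w = 0 \<and> v = M *v w + q"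

definition Q_matrix :: "real ^ 'n ^ 'n \<Rightarrow> bool" where
  "Q_matrix M \<longleftrightarrow> (\<forall>q. \<exists>v w. LCP_solution q M v w)"

subsection \<open>LCP-aligned trios and values\<close>

definition signature_matrices :: "(real ^ 'n ^ 'n) set" where
  "signature_matrices =
     {S. (\<forall>i j. i \<noteq> j \<longrightarrow> S $ i $ j = 0) \<and> (\<forall>i. S $ i $ i \<in> {- 1, 1})}"

definition LCP_aligned_trio ::
    "real ^ 'n ^ 'n \<Rightarrow> real \<Rightarrow> real ^ 'n ^ 'n \<Rightarrow> real ^ 'n \<Rightarrow> bool" where
  "LCP_aligned_trio M l S v \<longleftrightarrow>
     0 \<le> l \<and> S \<in> signature_matrices \<and> (\<forall>i. 0 \<le> v $ i) \<and> norm v = 1 \<and>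
     (M - mat 1) *v v = l *\<^sub>R (((M + mat 1) ** S) *v v)"

definition LCP_aligned_spectrum :: "real ^ 'n ^ 'n \<Rightarrow> real set" where
  "LCP_aligned_spectrum M = {l. \<exists>S v. LCP_aligned_trio M l S v}"

text \<open>
  The multiplicity and the count below are meant for LCP-generic \<open>M\<close>, for which all the sets
  involved are finite: each of the finitely many matrices \<open>S A\<close> has finitely many eigenvalues,
  and a simple one has at most one nonnegative unit eigenvector.
\<close>

definition LCP_aligned_multiplicity :: "real ^ 'n ^ 'n \<Rightarrow> real \<Rightarrow> nat" where
  "LCP_aligned_multiplicity M l = card {(S, v). LCP_aligned_trio M l S v}"

definition LCP_aligned_count :: "real ^ 'n ^ 'n \<Rightarrow> nat" where
  "LCP_aligned_count M =
     (\<Sum>l \<in> {l \<in> LCP_aligned_spectrum M. 1 < l}. LCP_aligned_multiplicity M l)"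

subsection \<open>Genericity\<close>

definition charpoly :: "real ^ 'n ^ 'n \<Rightarrow> real poly" where
  "charpoly A = det (mat [:0, 1:] - map_matrix (\<lambda>a. [:a:]) A)"

lemma poly_charpoly: "poly (charpoly A) x = det (mat x - A)"
  unfolding charpoly_def det_def
  by (simp add: poly_sum poly_prod mat_def map_matrix_def if_distrib[of "\<lambda>p. poly p x"]
        of_int_poly cong: if_cong)

text \<open>Simplicity refers to the algebraic multiplicity.\<close>

definition simple_eigenvalue :: "real ^ 'n ^ 'n \<Rightarrow> real \<Rightarrow> bool" where
  "simple_eigenvalue A l \<longleftrightarrow> order l (charpoly A) = 1"

definition generic_matrix :: "real ^ 'n ^ 'n \<Rightarrow> bool" where
  "generic_matrix A \<longleftrightarrow>
     (\<forall>l S v. 0 \<le> l \<and> S \<in> signature_matrices \<and> (\<forall>i. 0 \<le> v $ i) \<and> norm v = 1 \<and>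
        (S ** A) *v v = l *\<^sub>R v \<longrightarrow>
        simple_eigenvalue (S ** A) l \<and> (\<forall>i. 0 < v $ i))"

definition LCP_generic :: "real ^ 'n ^ 'n \<Rightarrow> bool" where
  "LCP_generic M \<longleftrightarrow>
     invertible (M + mat 1) \<and> generic_matrix (matrix_inv (M + mat 1) ** (M - mat 1))"

end

theory Submission
  imports Defs
begin

text \<open>
  With \<open>A = (M + I)\<^sup>-\<^sup>1 (M - I)\<close>, a solution of \<open>LCP(q, M)\<close> is a signature matrix \<open>S\<close> and a vector
  \<open>v \<ge> 0\<close> with \<open>(S - A) v = b\<close>, where \<open>b = 2 (M + I)\<^sup>-\<^sup>1 q\<close>, and an aligned trio is a nonnegative unit
  kernel vector of \<open>x S - A\<close>. For a right-hand side \<open>b\<close> in general position, count the signatures \<open>S\<close>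
  for which \<open>(x S - A) v = b\<close> has a positive solution while \<open>x\<close> descends from infinity to 1. The
  count starts at 1. Its parity does not change when a solution crosses a coordinate hyperplane
  \<open>v $ i = 0\<close>, because the numerator of \<open>v $ i\<close> in Cramer's rule does not involve the \<open>i\<close>-th column
  of \<open>x S - A\<close>, so that \<open>S\<close> and the signature with the \<open>i\<close>-th sign flipped jump together. It changes
  exactly once for each aligned trio, where the determinant has a simple zero and the solution
  escapes to infinity along a positive ray on one side only. If the number of trios is even, the
  count at 1 is therefore odd, so that the right-hand sides that are not attained, which form an
  open set because 1 is not an aligned value, contain no \<open>b\<close> in general position.
\<close>

section \<open>Parity and signs\<close>

text \<open>Induction on the set: removing one pair \<open>{x, f x}\<close> leaves a smaller set
  that \<open>f\<close> still maps to itself. The lemma serves to cancel wall crossings in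
  pairs.\<close>

lemma even_card_involution:
  assumes "finite X"
    and "\<And>x. x \<in> X \<Longrightarrow> f x \<in> X" "\<And>x. x \<in> X \<Longrightarrow> f x \<noteq> x" "\<And>x. x \<in> X \<Longrightarrow> f (f x) = x"
  shows "even (card X)"
  using assms
proof (induction X rule: finite_psubset_induct)
  case (psubset X)
  show ?case
  proof (cases "X = {}")
    case False
    then obtain x where x: "x \<in> X" by auto
    let ?Y = "X - {x, f x}"
    have fx: "f x \<in> X" "f x \<noteq> x" "f (f x) = x" using psubset.prems x by auto
    have Y: "f y \<in> ?Y" if "y \<in> ?Y" for y
    proof -
      have "f y \<in> X" "f (f y) = y" using that psubset.prems by auto
      then show ?thesis using that fx by auto
    qed
    have "even (card ?Y)"
      by (rule psubset.IH) (use x Y psubset.prems in auto)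
    moreover have "X = insert x (insert (f x) ?Y)" using x fx by auto
    then have "card X = Suc (Suc (card ?Y))"
      using psubset.hyps fx by (metis DiffD2 card_insert_disjoint finite_Diff finite_insert insertCI insertE)
    ultimately show ?thesis by simp
  qed simp
qed

text \<open>Reduces a comparison of the counts on the two sides of a point to the number of elements
  whose status changes.\<close>

lemma even_card_symdiff:
  assumes "finite X"
  shows "even (card {x \<in> X. P x} + card {x \<in> X. Q x} + card {x \<in> X. P x \<noteq> Q x})"
proof -
  have 1: "card {x \<in> X. P x} = card {x \<in> X. P x \<and> Q x} + card {x \<in> X. P x \<and> \<not> Q x}"
    by (subst card_Un_disjoint[symmetric]) (auto intro!: arg_cong[of _ _ card] simp: assms)
  have 2: "card {x \<in> X. Q x} = card {x \<in> X. P x \<and> Q x} + card {x \<in> X. \<not> P x \<and> Q x}"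
    by (subst card_Un_disjoint[symmetric]) (auto intro!: arg_cong[of _ _ card] simp: assms)
  have 3: "card {x \<in> X. P x \<noteq> Q x} = card {x \<in> X. P x \<and> \<not> Q x} + card {x \<in> X. \<not> P x \<and> Q x}"
    by (subst card_Un_disjoint[symmetric]) (auto intro!: arg_cong[of _ _ card] simp: assms)
  show ?thesis unfolding 1 2 3 by presburger
qed

section \<open>Signs of a function near a point\<close>

lemma eventually_sgn_eq:
  fixes f :: "real \<Rightarrow> real"
  assumes "(f \<longlongrightarrow> l) F" "l \<noteq> 0"
  shows "\<forall>\<^sub>F x in F. sgn (f x) = sgn l"
proof (cases "l > 0")
  case True
  then show ?thesis
    using order_tendstoD(1)[OF assms(1), of 0] by (auto elim: eventually_mono)
next
  case False
  then have "l < 0" using assms by simp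
  then show ?thesis
    using order_tendstoD(2)[OF assms(1), of 0] by (auto elim: eventually_mono)
qed

lemma tendsto_poly_at: "(poly p \<longlongrightarrow> poly p a) (at (a::real) within X)"
  by (intro tendsto_intros)

text \<open>Split off the full power of \<open>x - a\<close>. The cofactor keeps its sign near
  \<open>a\<close>, and the power is positive on the right and has sign
  \<open>(-1) ^ order a p\<close> on the left.\<close>

lemma poly_sgn_sides:
  fixes p :: "real poly"
  assumes "p \<noteq> 0"
  shows "\<exists>c. c \<in> {-1, 1} \<and> (\<forall>\<^sub>F x in at_right a. sgn (poly p x) = c) \<and>
    (\<forall>\<^sub>F x in at_left a. sgn (poly p x) = (-1) ^ order a p * c) \<and>
    (order a p = 0 \<longrightarrow> sgn (poly p a) = c)"
proof -
  obtain q where q: "p = [:- a, 1:] ^ order a p * q" "\<not> [:- a, 1:] dvd q"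
    using order_decomp[OF assms] by blast
  have qa: "poly q a \<noteq> 0" using q(2) by (simp add: poly_eq_0_iff_dvd)
  have p: "poly p x = (x - a) ^ order a p * poly q x" for x
    by (subst q(1)) (simp add: poly_power)
  have sq: "\<forall>\<^sub>F x in at a within X. sgn (poly q x) = sgn (poly q a)" for X
    by (rule eventually_sgn_eq[OF tendsto_poly_at qa])
  show ?thesis
  proof (intro exI[of _ "sgn (poly q a)"] conjI impI)
    show "sgn (poly q a) \<in> {-1, 1}" using qa by (auto simp: sgn_if)
    have "\<forall>\<^sub>F x in at_right a. x > a" by (simp add: eventually_at_filter)
    with sq[of "{a<..}"] show "\<forall>\<^sub>F x in at_right a. sgn (poly p x) = sgn (poly q a)"
      by eventually_elim (simp add: p sgn_mult)
    have "\<forall>\<^sub>F x in at_left a. x < a" by (simp add: eventually_at_filter)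
    with sq[of "{..<a}"] show "\<forall>\<^sub>F x in at_left a. sgn (poly p x) = (-1) ^ order a p * sgn (poly q a)"
      by eventually_elim (simp add: p sgn_mult power_sgn[symmetric])
    show "sgn (poly p a) = sgn (poly q a)" if "order a p = 0" using p[of a] that by simp
  qed
qed

text \<open>Only punctured neighbourhoods are used, since the parity to be tracked may be wrong at
  isolated points. The sets \<open>U True\<close> and \<open>U False\<close> are open, cover
  \<open>X\<close>, and are disjoint because no point of the real line is isolated; connectedness
  leaves only one of them.\<close>

lemma eventually_const_connected:
  fixes g :: "real \<Rightarrow> bool"
  assumes X: "open X" "connected X"
    and loc: "\<And>x. x \<in> X \<Longrightarrow> \<exists>c. \<forall>\<^sub>F y in at x. g y = c"
  shows "\<exists>c. \<forall>x\<in>X. \<forall>\<^sub>F y in at x. g y = c"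
proof -
  define U where "U c = {x \<in> X. \<forall>\<^sub>F y in at x. g y = c}" for c
  have "open (U c)" for c
  proof (subst open_subopen, safe)
    fix x assume x: "x \<in> U c"
    then obtain T where T: "open T" "x \<in> T" "\<And>y. y \<in> T \<Longrightarrow> y \<noteq> x \<Longrightarrow> g y = c"
      unfolding U_def eventually_at_topological by auto
    have "y \<in> U c" if y: "y \<in> T \<inter> X" for y
    proof (cases "y = x")
      case False
      have "open (T - {x})" "y \<in> T - {x}" "\<forall>z\<in>T - {x}. g z = c"
        using T y False by (auto intro: open_Diff)
      then show ?thesis using y unfolding U_def eventually_at_topological by blast
    qed (use x in simp)
    moreover have "open (T \<inter> X)" "x \<in> T \<inter> X" using T X x by (auto simp: U_def)
    ultimately show "\<exists>T. open T \<and> x \<in> T \<and> T \<subseteq> U c" by blast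
  qed
  moreover have "U True \<inter> U False = {}"
  proof -
    have False if "\<forall>\<^sub>F y in at x. g y = True" "\<forall>\<^sub>F y in at x. g y = False" for x
    proof -
      from that have "\<forall>\<^sub>F y in at x. False" by eventually_elim simp
      then show False by simp
    qed
    then show ?thesis by (auto simp: U_def)
  qed
  moreover have "X \<subseteq> U True \<union> U False"
  proof
    fix x assume "x \<in> X"
    with loc[of x] obtain c where "x \<in> U c" by (auto simp: U_def)
    then show "x \<in> U True \<union> U False" by (cases c) auto
  qed
  ultimately have "U True \<inter> X = {} \<or> U False \<inter> X = {}"
    using connectedD[OF X(2), of "U True" "U False"] by blast
  then have "X = U True \<or> X = U False"
    using \<open>X \<subseteq> U True \<union> U False\<close> by (auto simp: U_def)
  then show ?thesis by (metis (no_types, lifting) U_def mem_Collect_eq)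
qed

section \<open>The pencil of an aligned eigenvalue problem\<close>

lemma signature_mult_nth:
  assumes "S \<in> signature_matrices"
  shows "(S *v v) $ i = S $ i $ i * v $ i"
proof -
  have "(S *v v) $ i = (\<Sum>j\<in>UNIV. if j = i then S $ i $ i * v $ i else 0)"
    unfolding matrix_vector_mult_def vec_lambda_beta
    using assms by (intro sum.cong) (auto simp: signature_matrices_def)
  then show ?thesis by simp
qed

lemma signature_diag:
  assumes "S \<in> signature_matrices"
  shows "S $ i $ i = 1 \<or> S $ i $ i = -1"
  using assms by (auto simp: signature_matrices_def)

lemma signature_mult_mult:
  assumes "S \<in> signature_matrices"
  shows "S *v (S *v v) = v"
proof -
  have "(S *v (S *v v)) $ i = v $ i" for i
    using signature_diag[OF assms, of i] by (auto simp: signature_mult_nth[OF assms])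
  then show ?thesis by (simp add: vec_eq_iff)
qed

lemma signature_square:
  assumes "S \<in> signature_matrices"
  shows "S ** S = mat 1"
  unfolding matrix_eq by (simp flip: matrix_vector_mul_assoc add: signature_mult_mult[OF assms])

lemma norm_signature_mult:
  assumes "S \<in> signature_matrices"
  shows "norm (S *v v) = norm v"
proof -
  have "\<bar>(S *v v) $ i\<bar> = \<bar>v $ i\<bar>" for i
    using signature_diag[OF assms, of i] by (auto simp: signature_mult_nth[OF assms])
  then show ?thesis by (simp add: norm_vec_def)
qed

lemma det_signature_nonzero:
  assumes "S \<in> signature_matrices"
  shows "det S \<noteq> 0"
  using signature_square[OF assms] invertible_det_nz unfolding invertible_def by blast

lemma signature_eqI:
  assumes "S \<in> signature_matrices" "T \<in> signature_matrices" "\<And>i. S $ i $ i = T $ i $ i"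
  shows "S = T"
proof -
  have "S $ i $ j = T $ i $ j" for i j
    using assms by (cases "i = j") (auto simp: signature_matrices_def)
  then show ?thesis by (simp add: vec_eq_iff)
qed

lemma finite_signature_matrices: "finite (signature_matrices :: (real ^ 'n ^ 'n) set)"
proof (rule inj_on_finite[where f = "\<lambda>S. {i. S $ i $ i = 1}" and B = UNIV])
  show "inj_on (\<lambda>S::real^'n^'n. {i. S $ i $ i = 1}) signature_matrices"
  proof (rule inj_onI)
    fix S T :: "real ^ 'n ^ 'n"
    assume ST: "S \<in> signature_matrices" "T \<in> signature_matrices"
      and eq: "{i. S $ i $ i = 1} = {i. T $ i $ i = 1}"
    have "S $ i $ i = T $ i $ i" for i
      using signature_diag[OF ST(1), of i] signature_diag[OF ST(2), of i] eq
      by (auto simp: set_eq_iff) (metis one_neq_neg_one)+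
    then show "S = T" by (rule signature_eqI[OF ST])
  qed
qed auto

definition flip_sign :: "'n \<Rightarrow> real ^ 'n ^ 'n \<Rightarrow> real ^ 'n ^ 'n" where
  "flip_sign i S = (\<chi> a c. if a = i \<and> c = i then - S $ a $ c else S $ a $ c)"

lemma flip_sign_signature: "S \<in> signature_matrices \<Longrightarrow> flip_sign i S \<in> signature_matrices"
  unfolding signature_matrices_def flip_sign_def by auto

lemma flip_sign_flip_sign: "flip_sign i (flip_sign i S) = S"
  by (simp add: flip_sign_def vec_eq_iff)

lemma flip_sign_neq:
  assumes "S \<in> signature_matrices"
  shows "flip_sign i S \<noteq> S"
proof
  assume "flip_sign i S = S"
  then have "flip_sign i S $ i $ i = S $ i $ i" by simp
  then show False using signature_diag[OF assms, of i] by (auto simp: flip_sign_def)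
qed

text \<open>For a signature \<open>S\<close> this is \<open>S ** (mat x - S ** A)\<close>, so its
  kernel is the eigenspace of \<open>S ** A\<close> at \<open>x\<close>. In this form, flipping the
  \<open>i\<close>-th sign alters only the \<open>i\<close>-th column.\<close>

definition pencil :: "real ^ 'n ^ 'n \<Rightarrow> real ^ 'n ^ 'n \<Rightarrow> real \<Rightarrow> real ^ 'n ^ 'n" where
  "pencil A S x = x *\<^sub>R S - A"

definition orthant :: "(real ^ 'n) set" where
  "orthant = {v. \<forall>i. 0 \<le> v $ i}"

definition aligned :: "real ^ 'n ^ 'n \<Rightarrow> real ^ 'n ^ 'n \<Rightarrow> real \<Rightarrow> bool" where
  "aligned A S x \<longleftrightarrow> (\<exists>v\<in>orthant. v \<noteq> 0 \<and> pencil A S x *v v = 0)"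

lemma pencil_mult: "pencil A S x *v v = x *\<^sub>R (S *v v) - A *v v"
  by (simp add: pencil_def matrix_vector_mult_diff_rdistrib scaleR_matrix_vector_assoc)

lemma pencil_flip_sign:
  assumes "S \<in> signature_matrices" "v $ i = 0"
  shows "pencil A (flip_sign i S) x *v v = pencil A S x *v v"
proof -
  have "flip_sign i S *v v = S *v v"
    using assms by (simp add: vec_eq_iff signature_mult_nth flip_sign_signature)
      (simp add: flip_sign_def)
  then show ?thesis by (simp add: pencil_mult)
qed

lemma closed_orthant: "closed (orthant :: (real ^ 'n) set)"
  unfolding orthant_def by (intro closed_Collect_all closed_Collect_le continuous_intros)

lemma scaleR_orthant: "0 \<le> c \<Longrightarrow> v \<in> orthant \<Longrightarrow> c *\<^sub>R v \<in> orthant"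
  by (simp add: orthant_def)

text \<open>
  Solutions are homogenised: \<open>v\<close> solves the equation iff \<open>(v, 1)\<close>, scaled to the unit sphere, is a
  zero of \<open>(v, s) \<mapsto> pencil A S x *v v - s b\<close>; the points with \<open>s = 0\<close> are the aligned vectors.
\<close>

lemma pencil_orthant_stable:
  fixes A S :: "real ^ 'n ^ 'n"
  assumes S: "S \<in> signature_matrices"
    and na: "\<not> aligned A S x0"
    and b0: "\<And>v. v \<in> orthant \<Longrightarrow> pencil A S x0 *v v \<noteq> b0"
  obtains c where "c > 0"
    "\<And>x b v. \<bar>x - x0\<bar> + norm (b - b0) < c \<Longrightarrow> v \<in> orthant \<Longrightarrow> pencil A S x *v v \<noteq> b"
proof -
  define K where "K = (orthant \<times> {0..}) \<inter> sphere (0 :: (real ^ 'n) \<times> real) 1"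
  define f where "f x b = (\<lambda>(v, s). pencil A S x *v v - s *\<^sub>R b)" for x b
  have K: "compact K" unfolding K_def
    by (intro closed_Int_compact closed_Times closed_orthant) auto
  have pos: "norm (f x0 b0 p) > 0" if p: "p \<in> K" for p
  proof (rule ccontr)
    obtain v s where p: "p = (v, s)" by force
    assume "\<not> norm (f x0 b0 p) > 0"
    then have f0: "pencil A S x0 *v v = s *\<^sub>R b0" by (simp add: f_def p)
    have v: "v \<in> orthant" "s \<ge> 0" "norm (v, s) = 1" using \<open>p \<in> K\<close> by (auto simp: K_def p)
    show False
    proof (cases "s = 0")
      case True
      then have "v \<noteq> 0" using v(3) by auto
      then show False using na v(1) f0 True by (auto simp: aligned_def)
    next
      case False
      have "pencil A S x0 *v ((1 / s) *\<^sub>R v) = b0"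
        using f0 False by (simp add: matrix_vector_mult_scaleR)
      moreover have "(1 / s) *\<^sub>R v \<in> orthant" using v by (intro scaleR_orthant) auto
      ultimately show False using b0 by blast
    qed
  qed
  have cont: "continuous_on K (\<lambda>p. norm (f x0 b0 p))"
    unfolding f_def case_prod_unfold
    by (intro continuous_intros linear_continuous_on_compose[OF _ matrix_vector_mul_linear])
  \<comment> \<open>The homogenised map has no zero on the compact set \<open>K\<close>, so its norm
    is bounded below there by some \<open>c > 0\<close>.\<close>
  obtain c where c: "c > 0" "\<And>p. p \<in> K \<Longrightarrow> c \<le> norm (f x0 b0 p)"
  proof (cases "K = {}")
    case True
    then show ?thesis using that[of 1] by auto
  next
    case False
    then obtain q where "q \<in> K" "\<And>p. p \<in> K \<Longrightarrow> norm (f x0 b0 q) \<le> norm (f x0 b0 p)"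
      using continuous_attains_inf[OF K False cont] by blast
    then show ?thesis using that[of "norm (f x0 b0 q)"] pos by blast
  qed
  show ?thesis
  proof (rule that[OF c(1)])
    fix x and b v :: "real ^ 'n"
    assume close: "\<bar>x - x0\<bar> + norm (b - b0) < c" and v: "v \<in> orthant"
    show "pencil A S x *v v \<noteq> b"
    proof
      assume eq: "pencil A S x *v v = b"
      define r where "r = norm (v, 1::real)"
      have r: "r > 0" unfolding r_def by (simp add: zero_prod_def)
      define u s where "u = (1 / r) *\<^sub>R v" and "s = 1 / r"
      have us: "(u, s) = (1 / r) *\<^sub>R (v, 1)" by (simp add: u_def s_def)
      have "norm (u, s) = \<bar>1 / r\<bar> * r" by (simp only: us norm_scaleR r_def)
      then have n1: "norm (u, s) = 1" using r by simp
      have "u \<in> orthant" unfolding u_def by (rule scaleR_orthant) (use r v in auto)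
      moreover have "s \<ge> 0" using r by (simp add: s_def)
      ultimately have "(u, s) \<in> K" unfolding K_def using n1 by simp
      then have "c \<le> norm (f x0 b0 (u, s))" by (rule c(2))
      \<comment> \<open>Since \<open>(u, s)\<close> is a zero for the data \<open>(x, b)\<close>,
        only the change of data remains; \<open>norm u\<close> and \<open>s\<close> are at most 1,
        so it is bounded by the distance of the data.\<close>
      also have "f x0 b0 (u, s) = (x0 - x) *\<^sub>R (S *v u) + s *\<^sub>R (b - b0)"
      proof -
        have "pencil A S x *v u = s *\<^sub>R b"
          by (simp only: u_def s_def eq matrix_vector_mult_scaleR)
        then have "x *\<^sub>R (S *v u) - A *v u = s *\<^sub>R b" by (simp only: pencil_mult)
        then show ?thesis by (simp add: f_def pencil_mult scaleR_left_diff_distrib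
              scaleR_right_diff_distrib) (simp add: diff_eq_eq)
      qed
      also have "norm \<dots> \<le> \<bar>x0 - x\<bar> * norm u + \<bar>s\<bar> * norm (b - b0)"
        by (rule norm_triangle_le) (simp add: norm_signature_mult[OF S])
      also have "\<dots> \<le> \<bar>x0 - x\<bar> * 1 + 1 * norm (b - b0)"
      proof -
        have "norm u \<le> 1" "\<bar>s\<bar> \<le> 1"
          using norm_fst_le[of u s] norm_snd_le[of s u] n1 by auto
        then show ?thesis by (intro add_mono mult_mono) auto
      qed
      finally show False using close by (simp add: abs_minus_commute)
    qed
  qed
qed

text \<open>Normalising \<open>v\<close> and multiplying the kernel equation by \<open>S\<close>,
  its own inverse, gives the eigenvector equation that genericity speaks about.\<close>

lemma generic_aligned:
  assumes A: "generic_matrix A" and S: "S \<in> signature_matrices" and x: "0 \<le> x"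
    and v: "v \<in> orthant" "v \<noteq> 0" "pencil A S x *v v = 0"
  shows "order x (charpoly (S ** A)) = 1" "\<And>i. 0 < v $ i"
proof -
  define u where "u = (1 / norm v) *\<^sub>R v"
  have u: "norm u = 1" "u \<in> orthant" using v by (auto simp: u_def intro!: scaleR_orthant)
  have "pencil A S x *v u = 0" using v by (simp add: u_def matrix_vector_mult_scaleR)
  then have "A *v u = x *\<^sub>R (S *v u)" by (simp add: pencil_mult)
  then have "(S ** A) *v u = x *\<^sub>R u"
    by (simp flip: matrix_vector_mul_assoc add: matrix_vector_mult_scaleR signature_mult_mult[OF S])
  then have *: "simple_eigenvalue (S ** A) x \<and> (\<forall>i. 0 < u $ i)"
    using A S x u unfolding generic_matrix_def orthant_def by blast
  then show "order x (charpoly (S ** A)) = 1" by (simp add: simple_eigenvalue_def)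
  show "0 < v $ i" for i using * v(2) by (simp add: u_def zero_less_divide_iff)
qed

text \<open>
  A kernel vector not proportional to \<open>v\<close> could be combined with \<open>v\<close> to reach the boundary of the
  orthant, where genericity admits no kernel vector.
\<close>

lemma generic_kernel:
  fixes A :: "real ^ 'n ^ 'n"
  assumes A: "generic_matrix A" and S: "S \<in> signature_matrices" and x: "0 \<le> x"
    and v: "v \<in> orthant" "v \<noteq> 0" "pencil A S x *v v = 0"
    and w: "pencil A S x *v w = 0"
  obtains r where "w = r *\<^sub>R v"
proof -
  have vpos: "0 < v $ i" for i using generic_aligned(2)[OF A S x v] .
  \<comment> \<open>The largest multiple of \<open>v\<close> that can be subtracted from
    \<open>w\<close> without leaving the orthant; the coordinate attaining the minimum becomes
    zero.\<close>
  define r where "r = Min (range (\<lambda>i. w $ i / v $ i))"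
  define u where "u = w - r *\<^sub>R v"
  have "r \<in> range (\<lambda>i. w $ i / v $ i)" unfolding r_def by (rule Min_in) auto
  then obtain k where k: "r = w $ k / v $ k" by auto
  have "r \<le> w $ i / v $ i" for i unfolding r_def by (rule Min_le) auto
  then have "u \<in> orthant" using vpos by (auto simp: orthant_def u_def pos_le_divide_eq)
  moreover have "pencil A S x *v u = 0"
    using v w by (simp add: u_def matrix_vector_mult_diff_distrib matrix_vector_mult_scaleR)
  moreover have "u $ k = 0" using vpos[of k] by (simp add: u_def k)
  ultimately have "u = 0" using generic_aligned(2)[OF A S x, of u k] by auto
  then show ?thesis using that[of r] by (simp add: u_def)
qed

section \<open>Cramer numerators\<close>

lemma poly_det:
  fixes P :: "'a::comm_ring_1 poly ^ 'n ^ 'n"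
  shows "poly (det P) x = det (\<chi> i j. poly (P $ i $ j) x)"
  unfolding det_def by (simp add: poly_sum poly_prod of_int_poly)

lemma det_eq_0_iff_kernel:
  fixes B :: "real ^ 'n ^ 'n"
  shows "det B = 0 \<longleftrightarrow> (\<exists>v. v \<noteq> 0 \<and> B *v v = 0)"
proof -
  have "det B \<noteq> 0 \<longleftrightarrow> (\<forall>v. B *v v = 0 \<longrightarrow> v = 0)"
    unfolding invertible_det_nz[symmetric] invertible_left_inverse
    by (rule matrix_left_invertible_ker)
  then show ?thesis by blast
qed

text \<open>The determinant of the pencil as a polynomial in \<open>x\<close>. Written through
  \<open>charpoly\<close>, its root orders are the algebraic multiplicities that genericity
  controls.\<close>

definition pencil_det :: "real ^ 'n ^ 'n \<Rightarrow> real ^ 'n ^ 'n \<Rightarrow> real poly" where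
  "pencil_det A S = smult (det S) (charpoly (S ** A))"

text \<open>The numerator of coordinate \<open>k\<close> in Cramer's rule for
  \<open>pencil A S x *v v = b\<close>, as a polynomial in \<open>x\<close>.\<close>

definition numer :: "real ^ 'n ^ 'n \<Rightarrow> real ^ 'n ^ 'n \<Rightarrow> real ^ 'n \<Rightarrow> 'n \<Rightarrow> real poly" where
  "numer A S b k = det (\<chi> i j. if j = k then [:b $ i:] else [:- A $ i $ j, S $ i $ j:])"

lemma poly_pencil_det:
  assumes "S \<in> signature_matrices"
  shows "poly (pencil_det A S) x = det (pencil A S x)"
proof -
  have mat: "mat x *v v = x *\<^sub>R v" for v
  proof -
    have "(mat x *v v) $ i = (\<Sum>j\<in>UNIV. if j = i then x * v $ i else 0)" for i
      unfolding matrix_vector_mult_def vec_lambda_beta by (intro sum.cong) (auto simp: mat_def)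
    then show ?thesis by (simp add: vec_eq_iff)
  qed
  have "(S ** (mat x - S ** A)) *v v = pencil A S x *v v" for v
  proof -
    have "(S ** (mat x - S ** A)) *v v = S *v (mat x *v v - S *v (A *v v))"
      by (simp only: matrix_vector_mul_assoc[symmetric] matrix_vector_mult_diff_rdistrib)
    also have "\<dots> = x *\<^sub>R (S *v v) - A *v v"
      by (simp only: mat matrix_vector_mult_diff_distrib signature_mult_mult[OF assms]
          matrix_vector_mult_scaleR)
    finally show ?thesis by (simp only: pencil_mult)
  qed
  then have "S ** (mat x - S ** A) = pencil A S x" unfolding matrix_eq by blast
  then show ?thesis
    by (simp add: pencil_det_def poly_charpoly flip: det_mul)
qed

lemma poly_numer:
  "poly (numer A S b k) x = det (\<chi> i j. if j = k then b $ i else pencil A S x $ i $ j)"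
proof -
  have "(\<chi> i j. poly ((\<chi> i j. if j = k then [:b $ i:] else [:- A $ i $ j, S $ i $ j:]) $ i $ j) x)
     = (\<chi> i j. if j = k then b $ i else pencil A S x $ i $ j)"
    by (simp add: vec_eq_iff pencil_def)
  then show ?thesis by (simp only: numer_def poly_det)
qed

text \<open>The flipped entry lies in the column that \<open>b\<close> replaces.\<close>

lemma numer_flip_sign: "numer A (flip_sign k S) b k = numer A S b k"
proof -
  have "(\<chi> i j. if j = k then [:b $ i:] else [:- A $ i $ j, flip_sign k S $ i $ j:]) =
      (\<chi> i j. if j = k then [:b $ i:] else [:- A $ i $ j, S $ i $ j:])"
    by (simp add: vec_eq_iff flip_sign_def)
  then show ?thesis by (simp only: numer_def)
qed

text \<open>\<open>S\<close> is an isometry, so the term \<open>x *\<^sub>R (S *v v)\<close>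
  dominates \<open>A *v v\<close> once \<open>x\<close> exceeds the operator norm of
  \<open>A\<close>.\<close>

lemma pencil_coercive:
  fixes A :: "real ^ 'n ^ 'n"
  obtains C where "C \<ge> 0" "\<And>v. norm (A *v v) \<le> C * norm v"
    "\<And>S x v. S \<in> signature_matrices \<Longrightarrow> (x - C) * norm v \<le> norm (pencil A S x *v v)"
proof -
  define C where "C = onorm ((*v) A)"
  have C: "norm (A *v v) \<le> C * norm v" for v
    unfolding C_def by (rule onorm) (rule matrix_vector_mul_bounded_linear)
  show ?thesis
  proof (rule that[OF _ C])
    show "C \<ge> 0" unfolding C_def by (rule onorm_pos_le) (rule matrix_vector_mul_bounded_linear)
    fix S x and v :: "real ^ 'n"
    assume S: "S \<in> (signature_matrices :: (real ^ 'n ^ 'n) set)"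
    have "x * norm v \<le> norm (x *\<^sub>R (S *v v))"
      by (simp add: norm_signature_mult[OF S] mult_right_mono)
    also have "\<dots> \<le> norm (pencil A S x *v v) + norm (A *v v)"
      unfolding pencil_mult using norm_triangle_sub[of "x *\<^sub>R (S *v v)" "A *v v"] by simp
    finally show "(x - C) * norm v \<le> norm (pencil A S x *v v)"
      using C[of v] by (simp add: algebra_simps)
  qed
qed

lemma pencil_det_nonzero:
  assumes S: "S \<in> signature_matrices"
  shows "pencil_det A S \<noteq> 0"
proof
  assume 0: "pencil_det A S = 0"
  obtain C where C: "\<And>x v. (x - C) * norm v \<le> norm (pencil A S x *v v)"
    using pencil_coercive[of A] S by metis
  have "det (pencil A S (C + 1)) = 0" using 0 poly_pencil_det[OF S, of A "C + 1"] by simp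
  then obtain v where "v \<noteq> 0" "pencil A S (C + 1) *v v = 0" unfolding det_eq_0_iff_kernel by blast
  then show False using C[of "C + 1" v] by simp
qed

lemma pencil_solution_iff:
  assumes S: "S \<in> signature_matrices" and "poly (pencil_det A S) x \<noteq> 0"
  shows "pencil A S x *v v = b \<longleftrightarrow>
    v = (\<chi> k. poly (numer A S b k) x / poly (pencil_det A S) x)"
  using assms unfolding poly_numer poly_pencil_det[OF S] by (rule_tac cramer)

text \<open>Multiplied by the determinant, this is Cramer's rule, so it persists at singular points.\<close>

lemma pencil_numer:
  assumes S: "S \<in> signature_matrices"
  shows "(\<Sum>k\<in>UNIV. [:- A $ i $ k, S $ i $ k:] * numer A S b k) = pencil_det A S * [:b $ i:]"
    (is "?l = ?r")
proof -
  have "poly (pencil_det A S * (?l - ?r)) x = 0" for x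
  proof (cases "poly (pencil_det A S) x = 0")
    case False
    let ?D = "poly (pencil_det A S) x"
    have "pencil A S x *v (\<chi> k. poly (numer A S b k) x / ?D) = b"
      using pencil_solution_iff[OF S False] by blast
    then have "(\<Sum>k\<in>UNIV. pencil A S x $ i $ k * (poly (numer A S b k) x / ?D)) = b $ i"
      by (auto simp: vec_eq_iff matrix_vector_mult_def)
    then have "(\<Sum>k\<in>UNIV. pencil A S x $ i $ k * poly (numer A S b k) x) / ?D = b $ i"
      by (simp add: sum_divide_distrib)
    then have "(\<Sum>k\<in>UNIV. pencil A S x $ i $ k * poly (numer A S b k) x) = ?D * b $ i"
      using False by (simp add: field_simps)
    then show ?thesis by (simp add: poly_sum pencil_def algebra_simps)
  qed simp
  then have "pencil_det A S * (?l - ?r) = 0" using poly_all_0_iff_0 by blast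
  then show ?thesis using pencil_det_nonzero[OF S, of A] by simp
qed

text \<open>Stated for arbitrary \<open>p\<close> and \<open>q\<close>, so that it applies to the
  Cramer polynomials and also to what remains of them after a common linear factor is
  cancelled.\<close>

lemma pencil_mult_poly:
  assumes "S \<in> signature_matrices"
    and "\<And>i. (\<Sum>k\<in>UNIV. [:- A $ i $ k, S $ i $ k:] * p k) = q * [:b $ i:]"
  shows "pencil A S x *v (\<chi> k. poly (p k) x) = poly q x *\<^sub>R b"
proof -
  have "(pencil A S x *v (\<chi> k. poly (p k) x)) $ i = (poly q x *\<^sub>R b) $ i" for i
    using arg_cong[OF assms(2)[of i], of "\<lambda>p. poly p x"]
    by (simp add: poly_sum matrix_vector_mult_def pencil_def algebra_simps)
  then show ?thesis by (simp add: vec_eq_iff)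
qed

text \<open>Equal nonzero signs mean that every Cramer quotient is strictly positive. The form by
  signs makes one-sided behaviour accessible through the polynomials; singular \<open>x\<close>
  count as having no solution.\<close>

definition has_positive_solution ::
    "real ^ 'n ^ 'n \<Rightarrow> real ^ 'n ^ 'n \<Rightarrow> real ^ 'n \<Rightarrow> real \<Rightarrow> bool" where
  "has_positive_solution A S b x \<longleftrightarrow> poly (pencil_det A S) x \<noteq> 0 \<and>
     (\<forall>k. sgn (poly (numer A S b k) x) = sgn (poly (pencil_det A S) x))"

lemma has_positive_solutionD:
  assumes "S \<in> signature_matrices" "has_positive_solution A S b x"
  shows "\<exists>v\<in>orthant. pencil A S x *v v = b"
proof
  let ?v = "\<chi> k. poly (numer A S b k) x / poly (pencil_det A S) x"
  show "pencil A S x *v ?v = b"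
    using assms pencil_solution_iff unfolding has_positive_solution_def by blast
  have "0 \<le> poly (numer A S b k) x / poly (pencil_det A S) x" for k
  proof -
    have "sgn (poly (numer A S b k) x / poly (pencil_det A S) x) = 1"
      using assms(2) by (simp add: has_positive_solution_def sgn_divide sgn_zero_iff)
    then show ?thesis by (metis less_eq_real_def sgn_1_pos)
  qed
  then show "?v \<in> orthant" by (simp add: orthant_def)
qed

text \<open>For large \<open>x\<close> the solution is close to \<open>S *v b\<close> divided by
  \<open>x\<close>, so its \<open>k\<close>-th coordinate has the sign of
  \<open>S $ k $ k * b $ k\<close>.\<close>

lemma solutions_at_infinity:
  fixes A :: "real ^ 'n ^ 'n"
  assumes b: "\<And>i. b $ i \<noteq> 0"
  obtains L where
    "\<And>S x k. S \<in> signature_matrices \<Longrightarrow> x > L \<Longrightarrow> poly (numer A S b k) x \<noteq> 0"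
    "\<And>S x. S \<in> signature_matrices \<Longrightarrow> x > L \<Longrightarrow>
       has_positive_solution A S b x \<longleftrightarrow> (\<forall>k. S $ k $ k = sgn (b $ k))"
proof -
  obtain C where C: "C \<ge> 0" "\<And>v. norm (A *v v) \<le> C * norm v"
    "\<And>S x v. S \<in> signature_matrices \<Longrightarrow> (x - C) * norm v \<le> norm (pencil A S x *v v)"
    using pencil_coercive[of A] by metis
  define \<beta> where "\<beta> = Min (range (\<lambda>i. \<bar>b $ i\<bar>))"
  have "\<beta> \<in> range (\<lambda>i. \<bar>b $ i\<bar>)" unfolding \<beta>_def by (rule Min_in) auto
  then have \<beta>: "\<beta> > 0" using b by auto
  have \<beta>_le: "\<beta> \<le> \<bar>b $ i\<bar>" for i unfolding \<beta>_def by (rule Min_le) auto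
  \<comment> \<open>For \<open>x > L\<close> the bound \<open>C * norm b / (x - C)\<close> on
    \<open>norm (A *v v)\<close> lies below every \<open>\<bar>b $ i\<bar>\<close>, so
    \<open>A *v v\<close> cannot change the signs of \<open>b\<close>.\<close>
  define L where "L = C + C * norm b / \<beta>"
  have main: "poly (pencil_det A S) x \<noteq> 0 \<and> (\<forall>k. poly (numer A S b k) x \<noteq> 0 \<and>
      (sgn (poly (numer A S b k) x) = sgn (poly (pencil_det A S) x) \<longleftrightarrow> S $ k $ k = sgn (b $ k)))"
    if S: "S \<in> signature_matrices" and x: "x > L" for S x
  proof -
    have "C * norm b / \<beta> \<ge> 0" using C(1) \<beta> by simp
    then have xC: "x > C" "x > 0" using x C(1) by (auto simp: L_def)
    have D: "poly (pencil_det A S) x \<noteq> 0"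
    proof
      assume "poly (pencil_det A S) x = 0"
      then obtain v where "v \<noteq> 0" "pencil A S x *v v = 0"
        unfolding poly_pencil_det[OF S] det_eq_0_iff_kernel by blast
      then show False using C(3)[OF S, of x v] xC by (simp add: mult_le_0_iff)
    qed
    define v where "v = (\<chi> k. poly (numer A S b k) x / poly (pencil_det A S) x)"
    have v: "pencil A S x *v v = b" using pencil_solution_iff[OF S D] v_def by blast
    have "(x - C) * norm v \<le> norm b" using C(3)[OF S, of x v] v by simp
    then have "norm v \<le> norm b / (x - C)" using xC by (simp add: field_simps)
    then have "C * norm v \<le> C * (norm b / (x - C))" using C(1) by (rule mult_left_mono)
    also have "\<dots> < \<beta>" using x xC \<beta> by (simp add: L_def field_simps)
    finally have Av: "norm (A *v v) < \<beta>" using C(2)[of v] by linarith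
    have sv: "sgn (v $ k) = S $ k $ k * sgn (b $ k)" for k
    proof -
      have eq: "x * (S $ k $ k * v $ k) = b $ k + (A *v v) $ k"
        using v by (simp add: pencil_mult vec_eq_iff signature_mult_nth[OF S] algebra_simps)
      have "\<bar>(A *v v) $ k\<bar> < \<bar>b $ k\<bar>"
        using component_le_norm_cart[of "A *v v" k] Av \<beta>_le[of k] by linarith
      then have "sgn (b $ k + (A *v v) $ k) = sgn (b $ k)"
        by (auto simp: sgn_if abs_if split: if_splits)
      then have "sgn (x * (S $ k $ k * v $ k)) = sgn (b $ k)" unfolding eq .
      then show ?thesis
        using xC signature_diag[OF S, of k] by (auto simp: sgn_mult)
    qed
    have "poly (numer A S b k) x = v $ k * poly (pencil_det A S) x" for k
      using D by (simp add: v_def)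
    moreover have "v $ k \<noteq> 0" for k
      using sv[of k] b[of k] signature_diag[OF S, of k] by (auto simp: sgn_if split: if_splits)
    moreover have "sgn (v $ k) = 1 \<longleftrightarrow> S $ k $ k = sgn (b $ k)" for k
      using sv[of k] b[of k] signature_diag[OF S, of k] by (auto simp: sgn_if split: if_splits)
    ultimately show ?thesis using D by (simp add: sgn_mult sgn_zero_iff)
  qed
  show ?thesis
    by (rule that[of L]) (use main in \<open>auto simp: has_positive_solution_def\<close>)
qed

section \<open>One-sided signs of a polynomial at a point\<close>

definition rsgn :: "real \<Rightarrow> real poly \<Rightarrow> real" where
  "rsgn a p = (THE c. \<forall>\<^sub>F x in at_right a. sgn (poly p x) = c)"

text \<open>Derived from \<open>rsgn\<close> by the order of the zero, so that a sign change across
  a simple zero follows by unfolding.\<close>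

definition lsgn :: "real \<Rightarrow> real poly \<Rightarrow> real" where
  "lsgn a p = (-1) ^ order a p * rsgn a p"

lemma sgn_sides:
  assumes "p \<noteq> 0"
  shows rsgn_unit: "rsgn a p \<in> {-1, 1}"
    and eventually_rsgn: "\<forall>\<^sub>F x in at_right a. sgn (poly p x) = rsgn a p"
    and eventually_lsgn: "\<forall>\<^sub>F x in at_left a. sgn (poly p x) = lsgn a p"
    and rsgn_eq_sgn: "poly p a \<noteq> 0 \<Longrightarrow> rsgn a p = sgn (poly p a)"
    and lsgn_eq_sgn: "poly p a \<noteq> 0 \<Longrightarrow> lsgn a p = sgn (poly p a)"
proof -
  obtain c where c: "c \<in> {-1, 1}" "\<forall>\<^sub>F x in at_right a. sgn (poly p x) = c"
    "\<forall>\<^sub>F x in at_left a. sgn (poly p x) = (-1) ^ order a p * c"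
    "order a p = 0 \<longrightarrow> sgn (poly p a) = c"
    using poly_sgn_sides[OF assms, of a] by (elim exE conjE)
  have r: "rsgn a p = c" unfolding rsgn_def
  proof (rule the_equality[where P = "\<lambda>c. \<forall>\<^sub>F x in at_right a. sgn (poly p x) = c", OF c(2)])
    fix d assume "\<forall>\<^sub>F x in at_right a. sgn (poly p x) = d"
    with c(2) have "\<forall>\<^sub>F x in at_right a. d = c" by eventually_elim (rule trans[OF sym])
    then show "d = c" by simp
  qed
  show "rsgn a p \<in> {-1, 1}" "\<forall>\<^sub>F x in at_right a. sgn (poly p x) = rsgn a p"
    "\<forall>\<^sub>F x in at_left a. sgn (poly p x) = lsgn a p"
    unfolding lsgn_def r by (fact c(1), fact c(2), fact c(3))
  show "rsgn a p = sgn (poly p a)" "lsgn a p = sgn (poly p a)" if "poly p a \<noteq> 0"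
    using c(4) order_0I[OF that] by (simp_all add: lsgn_def r)
qed

lemma lsgn_unit:
  assumes "p \<noteq> 0"
  shows "lsgn a p \<in> {-1, 1}"
  using rsgn_unit[OF assms, of a] neg_one_even_power neg_one_odd_power
  by (cases "even (order a p)") (auto simp: lsgn_def)

section \<open>Regular right-hand sides\<close>

text \<open>The four clauses are the general position needed: the signs of \<open>b\<close> select
  one signature at infinity; no solution lies over a singular point of its own pencil; no solution
  on a wall lies over a singular point of any signature, in particular of the one across the wall;
  no solution meets two walls at once.\<close>

definition regular_rhs :: "real ^ 'n ^ 'n \<Rightarrow> real ^ 'n \<Rightarrow> bool" where
  "regular_rhs A b \<longleftrightarrow> (\<forall>i. b $ i \<noteq> 0) \<and>
    (\<forall>S\<in>signature_matrices. \<forall>x v.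
       poly (pencil_det A S) x = 0 \<longrightarrow> pencil A S x *v v \<noteq> b) \<and>
    (\<forall>S\<in>signature_matrices. \<forall>T\<in>signature_matrices. \<forall>x i v.
       poly (pencil_det A T) x = 0 \<longrightarrow> v $ i = 0 \<longrightarrow> pencil A S x *v v \<noteq> b) \<and>
    (\<forall>S\<in>signature_matrices. \<forall>x i j v.
       i \<noteq> j \<longrightarrow> v $ i = 0 \<longrightarrow> v $ j = 0 \<longrightarrow> pencil A S x *v v \<noteq> b)"

lemma regular_rhsD:
  assumes "regular_rhs A b" "S \<in> signature_matrices" "pencil A S x *v v = b"
  shows "poly (pencil_det A S) x \<noteq> 0"
    and "T \<in> signature_matrices \<Longrightarrow> v $ i = 0 \<Longrightarrow> poly (pencil_det A T) x \<noteq> 0"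
    and "v $ i = 0 \<Longrightarrow> v $ j = 0 \<Longrightarrow> i = j"
proof -
  show "poly (pencil_det A S) x \<noteq> 0"
    using assms unfolding regular_rhs_def by metis
  show "poly (pencil_det A T) x \<noteq> 0" if "T \<in> signature_matrices" "v $ i = 0"
    using assms that unfolding regular_rhs_def by metis
  show "i = j" if "v $ i = 0" "v $ j = 0"
    using assms that unfolding regular_rhs_def by metis
qed

section \<open>Irregular right-hand sides form a null set\<close>

lemma negligible_matrix_image:
  fixes B :: "real ^ 'n ^ 'n"
  assumes "negligible X"
  shows "negligible ((*v) B ` X)"
  by (rule negligible_differentiable_image_negligible[OF _ assms])
    (auto intro: linear_imp_differentiable_on)

lemma negligible_singular_range:
  fixes B :: "real ^ 'n ^ 'n"
  assumes "det B = 0"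
  shows "negligible (range ((*v) B))"
proof (rule negligible_linear_singular_image)
  show "\<not> inj ((*v) B)"
    using assms det_nz_iff_inj[of "(*v) B"] by simp
qed simp

text \<open>
  Two vanishing coordinates leave \<open>n - 2\<close> of them, so even with the parameter \<open>x\<close> the solution set
  has dimension below \<open>n\<close>. Here \<open>x\<close> is stored in coordinate \<open>i\<close>.
\<close>

lemma negligible_codim_two:
  fixes A S :: "real ^ 'n ^ 'n"
  assumes "i \<noteq> j"
  shows "negligible {pencil A S x *v v |x v. v $ i = 0 \<and> v $ j = 0}"
proof -
  define P where "P u = (\<chi> k. if k = i \<or> k = j then 0 else u $ k)" for u :: "real ^ 'n"
  have P: "linear P" by (rule linearI) (auto simp: P_def vec_eq_iff)
  define f where "f u = u $ i *\<^sub>R (S *v P u) - A *v P u" for u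
  have lin: "linear (\<lambda>u. S *v P u)" "linear (\<lambda>u. A *v P u)"
    using linear_compose[OF P matrix_vector_mul_linear] by (simp_all add: o_def)
  have "linear (\<lambda>u :: real ^ 'n. u $ i)" by (simp add: linear_iff)
  then have "f differentiable_on {u. u $ j = 0}"
    unfolding f_def
    by (intro differentiable_on_diff differentiable_on_scaleR linear_imp_differentiable_on lin) simp_all
  then have "negligible (f ` {u. u $ j = 0})"
    by (rule negligible_differentiable_image_negligible
        [OF order.refl negligible_standard_hyperplane_cart])
  moreover have "{pencil A S x *v v |x v. v $ i = 0 \<and> v $ j = 0} \<subseteq> f ` {u. u $ j = 0}"
  proof clarify
    fix x v assume v: "v $ i = (0::real)" "v $ j = 0"
    define u where "u = (\<chi> k. if k = i then x else v $ k)"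
    have "P u = v" using v by (auto simp: P_def u_def vec_eq_iff)
    then have "f u = pencil A S x *v v" by (simp add: f_def pencil_mult u_def)
    moreover have "u $ j = 0" using v assms by (simp add: u_def)
    ultimately show "pencil A S x *v v \<in> f ` {u. u $ j = 0}" by (intro image_eqI[where x = u]) simp_all
  qed
  ultimately show ?thesis by (rule negligible_subset)
qed

lemma finite_pencil_roots: "finite {x. \<exists>S\<in>signature_matrices. poly (pencil_det A S) x = 0}"
proof -
  have "{x. \<exists>S\<in>signature_matrices. poly (pencil_det A S) x = 0} =
      (\<Union>S\<in>signature_matrices. {x. poly (pencil_det A S) x = 0})" by auto
  then show ?thesis
    using finite_signature_matrices by (auto intro!: poly_roots_finite pencil_det_nonzero)
qed

lemma negligible_UN:
  assumes "finite I" "\<And>i. i \<in> I \<Longrightarrow> negligible (f i)"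
  shows "negligible (\<Union>i\<in>I. f i)"
  using assms by (intro negligible_Union) auto

lemma negligible_not_regular:
  fixes A :: "real ^ 'n ^ 'n"
  shows "negligible {b. \<not> regular_rhs A b}"
proof -
  let ?\<Sigma> = "signature_matrices :: (real ^ 'n ^ 'n) set"
  let ?R = "{x. \<exists>S\<in>?\<Sigma>. poly (pencil_det A S) x = 0}"
  \<comment> \<open>One set for each clause of regularity: coordinate hyperplanes, ranges of
    singular matrices, images of hyperplanes at the finitely many singular \<open>x\<close>, and
    families with two vanishing coordinates.\<close>
  let ?N1 = "\<Union>i. {b :: real ^ 'n. b $ i = 0}"
  let ?N2 = "\<Union>S\<in>?\<Sigma>. \<Union>x\<in>{x. poly (pencil_det A S) x = 0}. range ((*v) (pencil A S x))"
  let ?N3 = "\<Union>S\<in>?\<Sigma>. \<Union>x\<in>?R. \<Union>i. (*v) (pencil A S x) ` {v. v $ i = 0}"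
  let ?N4 = "\<Union>S\<in>?\<Sigma>. \<Union>(i, j)\<in>{(i, j). i \<noteq> j}.
    {pencil A S x *v v |x v. v $ i = 0 \<and> v $ j = 0}"
  have "negligible ?N1"
    by (intro negligible_UN negligible_standard_hyperplane_cart) simp
  moreover have "negligible ?N2"
  proof (intro negligible_UN finite_signature_matrices)
    fix S x assume S: "S \<in> ?\<Sigma>"
    show "finite {x. poly (pencil_det A S) x = 0}"
      by (rule poly_roots_finite[OF pencil_det_nonzero[OF S]])
    assume "x \<in> {x. poly (pencil_det A S) x = 0}"
    then show "negligible (range ((*v) (pencil A S x)))"
      by (intro negligible_singular_range) (simp add: poly_pencil_det[OF S])
  qed
  moreover have "negligible ?N3"
    by (intro negligible_UN finite_signature_matrices finite_pencil_roots
        negligible_matrix_image negligible_standard_hyperplane_cart) simp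
  moreover have "negligible ?N4"
  proof (intro negligible_UN finite_signature_matrices)
    fix S p assume "p \<in> {(i :: 'n, j). i \<noteq> j}"
    then show "negligible (case p of (i, j) \<Rightarrow> {pencil A S x *v v |x v. v $ i = 0 \<and> v $ j = 0})"
      using negligible_codim_two by auto
  qed simp
  ultimately have "negligible (?N1 \<union> ?N2 \<union> ?N3 \<union> ?N4)" by (intro negligible_Un)
  moreover have "{b. \<not> regular_rhs A b} \<subseteq> ?N1 \<union> ?N2 \<union> ?N3 \<union> ?N4"
  proof (rule subsetI, rule ccontr)
    fix b assume "b \<in> {b. \<not> regular_rhs A b}" and "b \<notin> ?N1 \<union> ?N2 \<union> ?N3 \<union> ?N4"
    then have b: "\<not> regular_rhs A b" "b \<notin> ?N1" "b \<notin> ?N2" "b \<notin> ?N3" "b \<notin> ?N4" by simp_all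
    have "regular_rhs A b"
      unfolding regular_rhs_def
    proof (intro conjI ballI allI impI)
      show "b $ i \<noteq> 0" for i using b(2) by simp
    next
      fix S x v assume "S \<in> ?\<Sigma>" "poly (pencil_det A S) x = 0"
      then show "pencil A S x *v v \<noteq> b" using b(3) by auto
    next
      fix S T x i and v :: "real ^ 'n"
      assume "S \<in> ?\<Sigma>" "T \<in> ?\<Sigma>" "poly (pencil_det A T) x = 0" "v $ i = 0"
      then show "pencil A S x *v v \<noteq> b" using b(4) by auto
    next
      fix S x i j and v :: "real ^ 'n"
      assume "S \<in> ?\<Sigma>" "i \<noteq> j" "v $ i = 0" "v $ j = 0"
      then show "pencil A S x *v v \<noteq> b" using b(5) by fastforce
    qed
    with b(1) show False ..
  qed
  ultimately show ?thesis by (rule negligible_subset)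
qed

text \<open>The numerators do not vanish for large \<open>x\<close>. As nonzero polynomials they
  have one-sided signs everywhere.\<close>

lemma regular_numer_nonzero:
  assumes "regular_rhs A b" "S \<in> signature_matrices"
  shows "numer A S b k \<noteq> 0"
proof -
  have "\<And>i. b $ i \<noteq> 0" using assms(1) by (simp add: regular_rhs_def)
  then obtain L where "\<And>x. x > L \<Longrightarrow> poly (numer A S b k) x \<noteq> 0"
    using solutions_at_infinity[of b A] assms(2) by metis
  from this[of "L + 1"] show ?thesis by auto
qed

section \<open>Jumps of the number of positive solutions\<close>

text \<open>The two sides express positive solvability just left and just right of \<open>x\<close>,
  as \<open>eventually_has_positive_solution\<close> shows.\<close>

definition jumps :: "real ^ 'n ^ 'n \<Rightarrow> real ^ 'n \<Rightarrow> real \<Rightarrow> real ^ 'n ^ 'n \<Rightarrow> bool" where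
  "jumps A b x S \<longleftrightarrow>
     (\<forall>k. lsgn x (numer A S b k) = lsgn x (pencil_det A S)) \<noteq>
     (\<forall>k. rsgn x (numer A S b k) = rsgn x (pencil_det A S))"

lemma eventually_has_positive_solution:
  assumes b: "regular_rhs A b" and S: "S \<in> signature_matrices"
  shows "\<forall>\<^sub>F x in at_left a. has_positive_solution A S b x \<longleftrightarrow>
           (\<forall>k. lsgn a (numer A S b k) = lsgn a (pencil_det A S))" (is ?L)
    and "\<forall>\<^sub>F x in at_right a. has_positive_solution A S b x \<longleftrightarrow>
           (\<forall>k. rsgn a (numer A S b k) = rsgn a (pencil_det A S))" (is ?R)
proof -
  note N = regular_numer_nonzero[OF b S] and D = pencil_det_nonzero[OF S]
  have "\<forall>\<^sub>F x in at_left a. \<forall>k. sgn (poly (numer A S b k) x) = lsgn a (numer A S b k)"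
    by (intro eventually_all_finite eventually_lsgn N)
  with eventually_lsgn[OF D, of A a] show ?L
  proof eventually_elim
    case (elim x)
    then have "poly (pencil_det A S) x \<noteq> 0"
      using lsgn_unit[OF D, of a A] by (auto simp: sgn_if split: if_splits)
    then show ?case using elim by (simp add: has_positive_solution_def)
  qed
  have "\<forall>\<^sub>F x in at_right a. \<forall>k. sgn (poly (numer A S b k) x) = rsgn a (numer A S b k)"
    by (intro eventually_all_finite eventually_rsgn N)
  with eventually_rsgn[OF D, of A a] show ?R
  proof eventually_elim
    case (elim x)
    then have "poly (pencil_det A S) x \<noteq> 0"
      using rsgn_unit[OF D, of a A] by (auto simp: sgn_if split: if_splits)
    then show ?case using elim by (simp add: has_positive_solution_def)
  qed
qed

text \<open>At \<open>x\<close> the determinant has a simple zero and changes sign, while the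
  numerators form a nonzero multiple of a strictly positive kernel vector and keep a common sign.
  The signs therefore agree on exactly one side.\<close>

lemma jumps_aligned:
  fixes A :: "real ^ 'n ^ 'n"
  assumes A: "generic_matrix A" and b: "regular_rhs A b" and S: "S \<in> signature_matrices"
    and x: "0 \<le> x" and al: "aligned A S x"
  shows "jumps A b x S"
proof -
  obtain v where v: "v \<in> orthant" "v \<noteq> 0" "pencil A S x *v v = 0"
    using al by (auto simp: aligned_def)
  have vpos: "0 < v $ i" for i using generic_aligned(2)[OF A S x v] .
  let ?D = "pencil_det A S" and ?N = "numer A S b"
  have D: "?D \<noteq> 0" by (rule pencil_det_nonzero[OF S])
  have "order x ?D = 1"
    using generic_aligned(1)[OF A S x v] det_signature_nonzero[OF S]
    by (simp add: pencil_det_def order_smult)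
  then obtain q where q: "?D = [:- x, 1:] * q" "poly q x \<noteq> 0"
    using order_decomp[OF D, of x] by (auto simp: poly_eq_0_iff_dvd)
  then have D0: "poly ?D x = 0" by simp
  have l: "lsgn x ?D = - rsgn x ?D" using \<open>order x ?D = 1\<close> by (simp add: lsgn_def)
  have "pencil A S x *v (\<chi> k. poly (?N k) x) = 0"
    using pencil_mult_poly[OF S, of A "?N" ?D b x] pencil_numer[OF S, of A _ b] D0 by simp
  then obtain r where r: "(\<chi> k. poly (?N k) x) = r *\<^sub>R v"
    using generic_kernel[OF A S x v] by blast
  then have N: "poly (?N k) x = r * v $ k" for k by (auto simp: vec_eq_iff)
  \<comment> \<open>Otherwise \<open>x\<close> is a root of all numerators. Cancelling it against
    the simple root of the determinant leaves a solution over the singular point \<open>x\<close>,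
    which regularity forbids.\<close>
  have "r \<noteq> 0"
  proof
    assume "r = 0"
    then have "[:- x, 1:] dvd ?N k" for k using N[of k] by (simp flip: poly_eq_0_iff_dvd)
    then have "\<exists>p. ?N k = [:- x, 1:] * p" for k unfolding dvd_def .
    then obtain p where p: "\<And>k. ?N k = [:- x, 1:] * p k" by metis
    have "(\<Sum>k\<in>UNIV. [:- A $ i $ k, S $ i $ k:] * p k) = q * [:b $ i:]" for i
    proof -
      have "[:- x, 1:] * (\<Sum>k\<in>UNIV. [:- A $ i $ k, S $ i $ k:] * p k) = [:- x, 1:] * (q * [:b $ i:])"
        using pencil_numer[OF S, where A = A and b = b and i = i] unfolding q(1) p sum_distrib_left
        by (simp only: mult.left_commute mult.assoc)
      then show ?thesis by (subst (asm) mult_cancel_left) simp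
    qed
    then have "pencil A S x *v (\<chi> k. poly (p k) x) = poly q x *\<^sub>R b"
      by (rule pencil_mult_poly[OF S])
    then have "pencil A S x *v ((1 / poly q x) *\<^sub>R (\<chi> k. poly (p k) x)) = b"
      using q(2) by (simp only: matrix_vector_mult_scaleR) simp
    then show False using regular_rhsD(1)[OF b S] D0 by blast
  qed
  then have "poly (?N k) x \<noteq> 0" "sgn (poly (?N k) x) = sgn r" for k
    using vpos[of k] by (simp_all add: N sgn_mult)
  then have "rsgn x (?N k) = sgn r" "lsgn x (?N k) = sgn r" for k
    using rsgn_eq_sgn[of "?N k" x] lsgn_eq_sgn[of "?N k" x] regular_numer_nonzero[OF b S]
    by auto
  then have "jumps A b x S \<longleftrightarrow> (sgn r = - rsgn x ?D) \<noteq> (sgn r = rsgn x ?D)"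
    by (simp add: jumps_def l)
  moreover have "sgn r = 1 \<or> sgn r = -1" using \<open>r \<noteq> 0\<close> by (simp add: sgn_if)
  moreover have "rsgn x ?D = 1 \<or> rsgn x ?D = -1" using rsgn_unit[OF D, of x] by auto
  ultimately show ?thesis by (elim disjE) simp_all
qed

text \<open>Without a solution in the orthant at \<open>x\<close> there is none nearby, and a
  strictly positive solution persists on both sides. A jump away from aligned points thus needs a
  solution on a wall.\<close>

lemma jumps_boundary:
  assumes b: "regular_rhs A b" and S: "S \<in> signature_matrices"
    and na: "\<not> aligned A S x" and jump: "jumps A b x S"
  obtains v i where "poly (pencil_det A S) x \<noteq> 0" "v \<in> orthant" "pencil A S x *v v = b" "v $ i = 0"
proof -
  let ?D = "pencil_det A S" and ?N = "numer A S b"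
  note ev = eventually_has_positive_solution[OF b S, of x]
  have "\<exists>v\<in>orthant. pencil A S x *v v = b"
  proof (rule ccontr)
    assume no: "\<not> ?thesis"
    then obtain c where c: "c > 0" "\<And>y b' v. \<bar>y - x\<bar> + norm (b' - b) < c \<Longrightarrow> v \<in> orthant \<Longrightarrow>
        pencil A S y *v v \<noteq> b'"
      using pencil_orthant_stable[OF S na, of b] by metis
    have never: "\<not> has_positive_solution A S b y" if "dist y x < c" for y
      using has_positive_solutionD[OF S, of A b y] c(2)[of y b] that by (auto simp: dist_real_def)
    have near: "\<forall>\<^sub>F y in at x within X. \<not> has_positive_solution A S b y" for X
      unfolding eventually_at using c(1) never by blast
    have "\<forall>\<^sub>F y in at_left x. \<not> (\<forall>k. lsgn x (?N k) = lsgn x ?D)"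
      using ev(1) near[of "{..<x}"] by eventually_elim simp
    moreover have "\<forall>\<^sub>F y in at_right x. \<not> (\<forall>k. rsgn x (?N k) = rsgn x ?D)"
      using ev(2) near[of "{x<..}"] by eventually_elim simp
    ultimately show False using jump unfolding jumps_def by simp
  qed
  then obtain v where v: "v \<in> orthant" "pencil A S x *v v = b" by blast
  then have D: "poly ?D x \<noteq> 0" using regular_rhsD(1)[OF b S] by blast
  have "\<exists>i. v $ i = 0"
  proof (rule ccontr)
    assume "\<not> ?thesis"
    then have vpos: "0 < v $ k" for k using v(1) by (auto simp: orthant_def less_le)
    have "v = (\<chi> k. poly (?N k) x / poly ?D x)" using v pencil_solution_iff[OF S D] by blast
    then have "poly (?N k) x = v $ k * poly ?D x" for k using D by simp
    then have "poly (?N k) x \<noteq> 0" "sgn (poly (?N k) x) = sgn (poly ?D x)" for k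
      using vpos[of k] D by (simp_all add: sgn_mult)
    then have "lsgn x (?N k) = lsgn x ?D" "rsgn x (?N k) = rsgn x ?D" for k
      using D regular_numer_nonzero[OF b S] pencil_det_nonzero[OF S]
      by (simp_all add: lsgn_eq_sgn rsgn_eq_sgn)
    then show False using jump by (simp add: jumps_def)
  qed
  then show ?thesis using that D v by blast
qed

text \<open>
  At a solution on the wall \<open>v $ i = 0\<close>, the only sign that may change is that of the \<open>i\<close>-th
  Cramer numerator, which does not depend on the \<open>i\<close>-th diagonal entry of \<open>S\<close>.
\<close>

lemma jumps_wall:
  assumes b: "regular_rhs A b" and S: "S \<in> signature_matrices"
    and D: "poly (pencil_det A S) x \<noteq> 0"
    and v: "v \<in> orthant" "pencil A S x *v v = b" "v $ i = 0"
  shows "jumps A b x S \<longleftrightarrow> lsgn x (numer A S b i) \<noteq> rsgn x (numer A S b i)"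
    and "poly (numer A S b k) x = 0 \<longleftrightarrow> k = i"
proof -
  let ?D = "pencil_det A S" and ?N = "numer A S b"
  have "v = (\<chi> k. poly (?N k) x / poly ?D x)" using v pencil_solution_iff[OF S D] by blast
  then have N: "poly (?N k) x = v $ k * poly ?D x" for k using D by simp
  have vpos: "0 < v $ k" if "k \<noteq> i" for k
  proof -
    have "v $ k \<noteq> 0" using regular_rhsD(3)[OF b S v(2), of i k] v(3) that by blast
    then show ?thesis using v(1) by (auto simp: orthant_def less_le)
  qed
  show "poly (?N k) x = 0 \<longleftrightarrow> k = i"
    using N[of k] vpos[of k] v(3) D by (cases "k = i") auto
  note nz = regular_numer_nonzero[OF b S] pencil_det_nonzero[OF S]
  have D': "lsgn x ?D = sgn (poly ?D x)" "rsgn x ?D = sgn (poly ?D x)"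
    using D nz by (simp_all add: lsgn_eq_sgn rsgn_eq_sgn)
  have "lsgn x (?N k) = lsgn x ?D \<and> rsgn x (?N k) = rsgn x ?D" if "k \<noteq> i" for k
  proof -
    have "poly (?N k) x \<noteq> 0" "sgn (poly (?N k) x) = sgn (poly ?D x)"
      using vpos[OF that] D by (simp_all add: N sgn_mult)
    then show ?thesis using D' nz by (simp add: lsgn_eq_sgn rsgn_eq_sgn)
  qed
  then have "(\<forall>k. lsgn x (?N k) = lsgn x ?D) \<longleftrightarrow> lsgn x (?N i) = lsgn x ?D"
    "(\<forall>k. rsgn x (?N k) = rsgn x ?D) \<longleftrightarrow> rsgn x (?N i) = rsgn x ?D"
    by metis+
  then have "jumps A b x S \<longleftrightarrow>
      (lsgn x (?N i) = sgn (poly ?D x)) \<noteq> (rsgn x (?N i) = sgn (poly ?D x))"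
    by (simp only: jumps_def D')
  moreover have "sgn (poly ?D x) = 1 \<or> sgn (poly ?D x) = -1" using D by (simp add: sgn_if)
  moreover have "lsgn x (?N i) = 1 \<or> lsgn x (?N i) = -1" "rsgn x (?N i) = 1 \<or> rsgn x (?N i) = -1"
    using lsgn_unit[OF nz(1), of x i] rsgn_unit[OF nz(1), of x i] by auto
  ultimately show "jumps A b x S \<longleftrightarrow> lsgn x (?N i) \<noteq> rsgn x (?N i)"
    by (elim disjE) simp_all
qed

text \<open>As \<open>v $ i = 0\<close>, the same \<open>v\<close> solves the flipped system, which
  regularity makes nonsingular. Both jumps are then decided by the shared numerator
  \<open>numer A S b i\<close>.\<close>

lemma jumps_flip_sign:
  assumes b: "regular_rhs A b" and S: "S \<in> signature_matrices"
    and D: "poly (pencil_det A S) x \<noteq> 0"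
    and v: "v \<in> orthant" "pencil A S x *v v = b" "v $ i = 0"
  shows "jumps A b x (flip_sign i S) \<longleftrightarrow> jumps A b x S"
    and "poly (pencil_det A (flip_sign i S)) x \<noteq> 0"
    and "poly (numer A (flip_sign i S) b k) x = 0 \<longleftrightarrow> k = i"
proof -
  note S' = flip_sign_signature[OF S, of i]
  show D': "poly (pencil_det A (flip_sign i S)) x \<noteq> 0"
    using regular_rhsD(2)[OF b S v(2) S' v(3)] .
  have v': "pencil A (flip_sign i S) x *v v = b"
    using pencil_flip_sign[where A = A and x = x and v = v, OF S v(3)] v(2) by simp
  show "jumps A b x (flip_sign i S) \<longleftrightarrow> jumps A b x S"
    using jumps_wall(1)[OF b S' D' v(1) v' v(3)] jumps_wall(1)[OF b S D v]
    by (simp add: numer_flip_sign)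
  show "poly (numer A (flip_sign i S) b k) x = 0 \<longleftrightarrow> k = i"
    by (rule jumps_wall(2)[OF b S' D' v(1) v' v(3)])
qed

lemma not_aligned_nonsingular:
  assumes "S \<in> signature_matrices" "poly (pencil_det A S) x \<noteq> 0"
  shows "\<not> aligned A S x"
  using assms det_eq_0_iff_kernel unfolding aligned_def poly_pencil_det[OF assms(1)] by blast

text \<open>Every aligned signature jumps; the other jumping signatures are paired by flipping the
  sign at their wall.\<close>

lemma even_jumps_aligned:
  fixes A :: "real ^ 'n ^ 'n"
  assumes A: "generic_matrix A" and b: "regular_rhs A b" and x: "0 \<le> x"
  shows "even (card {S \<in> signature_matrices. jumps A b x S} +
               card {S \<in> signature_matrices. aligned A S x})"
proof -
  let ?al = "{S \<in> signature_matrices. aligned A S x}"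
  let ?X = "{S \<in> signature_matrices. jumps A b x S \<and> \<not> aligned A S x}"
  \<comment> \<open>On \<open>?X\<close> the wall is the only index whose numerator vanishes at
    \<open>x\<close>. The flipped signature yields the same index, which makes \<open>f\<close> an
    involution.\<close>
  define f where "f S = flip_sign (THE i. poly (numer A S b i) x = 0) S" for S
  have fX: "f S \<in> ?X \<and> f S \<noteq> S \<and> f (f S) = S" if "S \<in> ?X" for S
  proof -
    have S: "S \<in> signature_matrices" "\<not> aligned A S x" "jumps A b x S" using that by auto
    obtain v i where v: "poly (pencil_det A S) x \<noteq> 0" "v \<in> orthant" "pencil A S x *v v = b"
        "v $ i = 0"
      using jumps_boundary[OF b S] by blast
    have f: "f S = flip_sign i S"
      using jumps_wall(2)[OF b S(1) v] by (simp add: f_def)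
    have ff: "f (flip_sign i S) = S"
      using jumps_flip_sign(3)[OF b S(1) v] by (simp add: f_def flip_sign_flip_sign)
    show ?thesis
      unfolding f ff using S jumps_flip_sign(1,2)[OF b S(1) v] flip_sign_neq[OF S(1)]
        flip_sign_signature[OF S(1), of i] not_aligned_nonsingular by blast
  qed
  have fin: "finite {S \<in> signature_matrices. P S}" for P :: "real ^ 'n ^ 'n \<Rightarrow> bool"
    by (rule finite_subset[OF _ finite_signature_matrices]) auto
  have "even (card ?X)"
    by (rule even_card_involution[OF fin, of _ f]) (use fX in blast)+
  moreover have "{S \<in> signature_matrices. jumps A b x S} = ?X \<union> ?al"
    using jumps_aligned[OF A b _ x] by blast
  then have "card {S \<in> signature_matrices. jumps A b x S} = card ?X + card ?al"
    by (simp only:) (rule card_Un_disjoint[OF fin fin], blast)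
  ultimately show ?thesis by simp
qed

section \<open>Surjectivity by parity\<close>

definition aligned_sigs :: "real ^ 'n ^ 'n \<Rightarrow> real \<Rightarrow> (real ^ 'n ^ 'n) set" where
  "aligned_sigs A l = {S \<in> signature_matrices. aligned A S l}"

definition aligned_values_gt1 :: "real ^ 'n ^ 'n \<Rightarrow> real set" where
  "aligned_values_gt1 A = {l. 1 < l \<and> aligned_sigs A l \<noteq> {}}"

lemma finite_aligned_values_gt1: "finite (aligned_values_gt1 A)"
proof (rule finite_subset[OF _ finite_pencil_roots[of A]])
  show "aligned_values_gt1 A \<subseteq> {x. \<exists>S\<in>signature_matrices. poly (pencil_det A S) x = 0}"
    using not_aligned_nonsingular[of _ A] by (auto simp: aligned_values_gt1_def aligned_sigs_def)
qed

text \<open>The invariant of the descent: adding the aligned signatures at values in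
  \<open>(1, x)\<close> compensates for the parity change at each of them.\<close>

definition solution_parity :: "real ^ 'n ^ 'n \<Rightarrow> real ^ 'n \<Rightarrow> real \<Rightarrow> bool" where
  "solution_parity A b x \<longleftrightarrow> even (card {S \<in> signature_matrices. has_positive_solution A S b x} +
     (\<Sum>l \<in> {l \<in> aligned_values_gt1 A. l < x}. card (aligned_sigs A l)))"

text \<open>The one-sided values differ by the parity of the jumps at \<open>a\<close> plus the
  signatures aligned at \<open>a\<close>, a sum that is even.\<close>

lemma eventually_solution_parity:
  fixes A :: "real ^ 'n ^ 'n"
  assumes A: "generic_matrix A" and b: "regular_rhs A b" and a: "1 < a"
  shows "\<exists>c. \<forall>\<^sub>F x in at a. solution_parity A b x = c"
proof -
  let ?\<Sigma> = "signature_matrices :: (real ^ 'n ^ 'n) set"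
  let ?V = "aligned_values_gt1 A"
  let ?L = "\<lambda>S. \<forall>k. lsgn a (numer A S b k) = lsgn a (pencil_det A S)"
  let ?R = "\<lambda>S. \<forall>k. rsgn a (numer A S b k) = rsgn a (pencil_det A S)"
  let ?m = "\<lambda>I. \<Sum>l\<in>I. card (aligned_sigs A l)"
  \<comment> \<open>An aligned value at \<open>a\<close> itself is counted just to the right of
    \<open>a\<close> but not to the left, hence \<open>l \<le> a\<close> against
    \<open>l < a\<close>.\<close>
  define l0 r0 where "l0 \<longleftrightarrow> even (card {S \<in> ?\<Sigma>. ?L S} + ?m {l \<in> ?V. l < a})"
    and "r0 \<longleftrightarrow> even (card {S \<in> ?\<Sigma>. ?R S} + ?m {l \<in> ?V. l \<le> a})"
  have "\<forall>\<^sub>F x in at_left a. \<forall>S\<in>?\<Sigma>. has_positive_solution A S b x \<longleftrightarrow> ?L S"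
    by (intro eventually_ball_finite finite_signature_matrices ballI
        eventually_has_positive_solution(1)[OF b])
  moreover have "\<forall>\<^sub>F x in at_left a. \<forall>l\<in>?V. l < x \<longleftrightarrow> l < a"
  proof (intro eventually_ball_finite finite_aligned_values_gt1 ballI)
    fix l
    have *: "\<forall>\<^sub>F x in at_left a. x < a" by (simp add: eventually_at_filter)
    show "\<forall>\<^sub>F x in at_left a. (l < x) = (l < a)"
    proof (cases "l < a")
      case True
      then have "\<forall>\<^sub>F x in at_left a. l < x"
        by (intro order_tendstoD(1)[OF tendsto_ident_at])
      then show ?thesis using True by (auto elim: eventually_mono)
    next
      case False
      with * show ?thesis by (auto elim: eventually_mono)
    qed
  qed
  ultimately have left: "\<forall>\<^sub>F x in at_left a. solution_parity A b x = l0"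
  proof eventually_elim
    case (elim x)
    then have "{S \<in> ?\<Sigma>. has_positive_solution A S b x} = {S \<in> ?\<Sigma>. ?L S}"
      "{l \<in> ?V. l < x} = {l \<in> ?V. l < a}" by auto
    then show ?case by (simp only: solution_parity_def l0_def)
  qed
  have "\<forall>\<^sub>F x in at_right a. \<forall>S\<in>?\<Sigma>. has_positive_solution A S b x \<longleftrightarrow> ?R S"
    by (intro eventually_ball_finite finite_signature_matrices ballI
        eventually_has_positive_solution(2)[OF b])
  moreover have "\<forall>\<^sub>F x in at_right a. \<forall>l\<in>?V. l < x \<longleftrightarrow> l \<le> a"
  proof (intro eventually_ball_finite finite_aligned_values_gt1 ballI)
    fix l
    have *: "\<forall>\<^sub>F x in at_right a. a < x" by (simp add: eventually_at_filter)
    show "\<forall>\<^sub>F x in at_right a. (l < x) = (l \<le> a)"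
    proof (cases "a < l")
      case True
      then have "\<forall>\<^sub>F x in at_right a. x < l"
        by (intro order_tendstoD(2)[OF tendsto_ident_at])
      then show ?thesis using True by (auto elim: eventually_mono)
    next
      case False
      with * show ?thesis by (auto elim: eventually_mono)
    qed
  qed
  ultimately have right: "\<forall>\<^sub>F x in at_right a. solution_parity A b x = r0"
  proof eventually_elim
    case (elim x)
    then have "{S \<in> ?\<Sigma>. has_positive_solution A S b x} = {S \<in> ?\<Sigma>. ?R S}"
      "{l \<in> ?V. l < x} = {l \<in> ?V. l \<le> a}" by auto
    then show ?case by (simp only: solution_parity_def r0_def)
  qed
  have m: "?m {l \<in> ?V. l \<le> a} = ?m {l \<in> ?V. l < a} + card (aligned_sigs A a)"
  proof (cases "a \<in> ?V")
    case True
    then have "{l \<in> ?V. l \<le> a} = insert a {l \<in> ?V. l < a}" by auto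
    then show ?thesis using finite_aligned_values_gt1[of A] by simp
  next
    case False
    then have "{l \<in> ?V. l \<le> a} = {l \<in> ?V. l < a}" by (auto simp: le_less)
    moreover have "aligned_sigs A a = {}" using False a by (simp add: aligned_values_gt1_def)
    ultimately show ?thesis by simp
  qed
  have "even (card {S \<in> ?\<Sigma>. ?L S} + card {S \<in> ?\<Sigma>. ?R S} + card {S \<in> ?\<Sigma>. jumps A b a S})"
    unfolding jumps_def by (rule even_card_symdiff[OF finite_signature_matrices])
  moreover have "even (card {S \<in> ?\<Sigma>. jumps A b a S} + card (aligned_sigs A a))"
    unfolding aligned_sigs_def by (rule even_jumps_aligned[OF A b]) (use a in simp)
  ultimately have "l0 = r0"
    unfolding l0_def r0_def m by presburger
  with left right show ?thesis unfolding eventually_at_split by blast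
qed

text \<open>Stability with the parameter held at \<open>x\<close> gives an open set for each
  signature, and there are finitely many signatures.\<close>

lemma open_missed_rhs:
  fixes A :: "real ^ 'n ^ 'n"
  assumes "\<And>S. S \<in> signature_matrices \<Longrightarrow> \<not> aligned A S x"
  shows "open {b. \<forall>S\<in>signature_matrices. \<forall>v\<in>orthant. pencil A S x *v v \<noteq> b}"
proof -
  have "open {b. \<forall>v\<in>orthant. pencil A S x *v v \<noteq> b}" if S: "S \<in> signature_matrices" for S
    unfolding open_dist
  proof (intro ballI, unfold mem_Collect_eq)
    fix b assume "\<forall>v\<in>orthant. pencil A S x *v v \<noteq> b"
    then obtain c where "c > 0" "\<And>y b' v. \<bar>y - x\<bar> + norm (b' - b) < c \<Longrightarrow> v \<in> orthant \<Longrightarrow>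
        pencil A S y *v v \<noteq> b'"
      using pencil_orthant_stable[OF S assms[OF S], of b] by metis
    from this(1) this(2)[of x]
    show "\<exists>e>0. \<forall>y. dist y b < e \<longrightarrow> (\<forall>v\<in>orthant. pencil A S x *v v \<noteq> y)"
      by (auto simp: dist_norm)
  qed
  then have "open (\<Inter>S\<in>signature_matrices. {b. \<forall>v\<in>orthant. pencil A S x *v v \<noteq> b})"
    by (intro open_INT finite_signature_matrices) auto
  moreover have "(\<Inter>S\<in>signature_matrices. {b. \<forall>v\<in>orthant. pencil A S x *v v \<noteq> b}) =
      {b. \<forall>S\<in>signature_matrices. \<forall>v\<in>orthant. pencil A S x *v v \<noteq> b}" by auto
  ultimately show ?thesis by simp
qed

text \<open>Far out exactly one signature, the sign pattern of \<open>b\<close>, has a positive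
  solution, and the aligned total is even.\<close>

lemma solution_parity_at_infinity:
  fixes A :: "real ^ 'n ^ 'n"
  assumes b: "\<And>i. b $ i \<noteq> 0" and even: "even (\<Sum>l\<in>aligned_values_gt1 A. card (aligned_sigs A l))"
  shows "\<forall>\<^sub>F x in at_top. \<not> solution_parity A b x"
proof -
  obtain L where L: "\<And>S x. S \<in> signature_matrices \<Longrightarrow> x > L \<Longrightarrow>
      has_positive_solution A S b x \<longleftrightarrow> (\<forall>k. S $ k $ k = sgn (b $ k))"
    using solutions_at_infinity[OF b, of A] by metis
  define S0 :: "real ^ 'n ^ 'n" where "S0 = (\<chi> i j. if i = j then sgn (b $ i) else 0)"
  have S0: "S0 \<in> signature_matrices" using b by (auto simp: S0_def signature_matrices_def sgn_if)
  have "\<forall>\<^sub>F x in at_top. \<forall>l\<in>aligned_values_gt1 A. l < x"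
    by (intro eventually_ball_finite finite_aligned_values_gt1 ballI eventually_gt_at_top)
  then show ?thesis using eventually_gt_at_top[of L]
  proof eventually_elim
    case (elim x)
    have "has_positive_solution A S b x \<longleftrightarrow> S = S0" if S: "S \<in> signature_matrices" for S
      unfolding L[OF S elim(2)]
    proof
      assume *: "\<forall>k. S $ k $ k = sgn (b $ k)"
      show "S = S0" by (rule signature_eqI[OF S S0]) (simp add: * S0_def)
    qed (simp add: S0_def)
    then have "{S \<in> signature_matrices. has_positive_solution A S b x} = {S0}" using S0 by blast
    moreover have "{l \<in> aligned_values_gt1 A. l < x} = aligned_values_gt1 A" using elim by auto
    ultimately show ?case using even by (simp add: solution_parity_def)
  qed
qed

text \<open>Being missed at 1 persists slightly to the right, and the finitely many aligned values
  above 1 stay away from 1, so both counts are zero.\<close>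

lemma solution_parity_at_1:
  fixes A :: "real ^ 'n ^ 'n"
  assumes na: "\<And>S. S \<in> signature_matrices \<Longrightarrow> \<not> aligned A S 1"
    and b: "\<And>S v. S \<in> signature_matrices \<Longrightarrow> v \<in> orthant \<Longrightarrow> pencil A S 1 *v v \<noteq> b"
  shows "\<forall>\<^sub>F x in at_right 1. solution_parity A b x"
proof -
  have "\<forall>\<^sub>F x in at_right 1. \<forall>S\<in>signature_matrices. \<not> has_positive_solution A S b x"
  proof (intro eventually_ball_finite finite_signature_matrices ballI)
    fix S :: "real ^ 'n ^ 'n" assume S: "S \<in> signature_matrices"
    obtain c where c: "c > 0" "\<And>y b' v. \<bar>y - 1\<bar> + norm (b' - b) < c \<Longrightarrow> v \<in> orthant \<Longrightarrow>
        pencil A S y *v v \<noteq> b'"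
      using pencil_orthant_stable[OF S na[OF S], of b] b[OF S] by metis
    have "\<not> has_positive_solution A S b y" if "dist y 1 < c" for y
      using has_positive_solutionD[OF S, of A b y] c(2)[of y b] that by (auto simp: dist_real_def)
    then show "\<forall>\<^sub>F y in at_right 1. \<not> has_positive_solution A S b y"
      unfolding eventually_at using c(1) by blast
  qed
  moreover have "\<forall>\<^sub>F x in at_right 1. \<forall>l\<in>aligned_values_gt1 A. x < l"
    by (intro eventually_ball_finite finite_aligned_values_gt1 ballI
        order_tendstoD(2)[OF tendsto_ident_at]) (simp add: aligned_values_gt1_def)
  ultimately show ?thesis
  proof eventually_elim
    case (elim x)
    then have "{S \<in> signature_matrices. has_positive_solution A S b x} = {}"
      "{l \<in> aligned_values_gt1 A. l < x} = {}" by force+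
    then show ?case by (simp only: solution_parity_def) simp
  qed
qed

theorem pencil_surjective:
  fixes A :: "real ^ 'n ^ 'n"
  assumes A: "generic_matrix A"
    and na: "\<And>S. S \<in> signature_matrices \<Longrightarrow> \<not> aligned A S 1"
    and even: "even (\<Sum>l\<in>aligned_values_gt1 A. card (aligned_sigs A l))"
  shows "\<exists>S\<in>signature_matrices. \<exists>v\<in>orthant. pencil A S 1 *v v = b"
proof (rule ccontr)
  let ?O = "{b. \<forall>S\<in>signature_matrices. \<forall>v\<in>orthant. pencil A S 1 *v v \<noteq> b}"
  assume "\<not> ?thesis"
  then have "b \<in> ?O" by blast
  \<comment> \<open>A nonempty open set is not negligible, so some missed right-hand side is also
    regular.\<close>
  then have "\<not> negligible ?O" using open_not_negligible[OF open_missed_rhs[OF na]] by blast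
  then have "\<not> ?O \<subseteq> {b. \<not> regular_rhs A b}" 
    by (rule contrapos_nn) (rule negligible_subset[OF negligible_not_regular])
  then obtain d where "d \<in> ?O" "d \<notin> {b. \<not> regular_rhs A b}" by (meson subsetI)
  then have d: "d \<in> ?O" "regular_rhs A d" by simp_all
  obtain c where c: "\<forall>a\<in>{1<..}. \<forall>\<^sub>F x in at a. solution_parity A d x = c"
    using eventually_const_connected[of "{1<..}" "solution_parity A d"]
      eventually_solution_parity[OF A d(2)] by auto
  \<comment> \<open>\<open>c\<close> is the value of the parity off isolated points; any open set
    beyond 1 on which the parity is known determines it. Near 1 and near infinity the answers
    conflict.\<close>
  have c_eq: "c = e" if X: "open X" "a \<in> X" "1 < a" "\<And>x. x \<in> X \<Longrightarrow> solution_parity A d x = e" for X a e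
  proof -
    have "\<forall>\<^sub>F x in at a. x \<in> X" using eventually_at_in_open'[OF X(1,2)] .
    moreover have "\<forall>\<^sub>F x in at a. solution_parity A d x = c" using c X(3) by simp
    ultimately have "\<forall>\<^sub>F x in at a. c = e" by eventually_elim (use X(4) in simp)
    then show ?thesis by simp
  qed
  obtain u where u: "1 < u" "\<And>x. 1 < x \<Longrightarrow> x < u \<Longrightarrow> solution_parity A d x"
    using solution_parity_at_1[OF na, of d] d(1) unfolding eventually_at_right_field by auto
  have "c = True"
    by (rule c_eq[of "{1<..<u}" "(1 + u) / 2"]) (use u in auto)
  moreover
  have "\<And>i. d $ i \<noteq> 0" using d(2) by (simp add: regular_rhs_def)
  then obtain l where l: "\<And>x. x \<ge> l \<Longrightarrow> \<not> solution_parity A d x"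
    using solution_parity_at_infinity[OF _ even, of d] unfolding eventually_at_top_linorder by auto
  have "c = False"
    by (rule c_eq[of "{l<..}" "max l 1 + 1"]) (use l in auto)
  ultimately show False by simp
qed

section \<open>Linear complementarity\<close>

lemma matrix_inv_mult:
  assumes "invertible P"
  shows "P *v (matrix_inv P *v v) = v" "matrix_inv P *v (P *v v) = v"
proof -
  have "P ** matrix_inv P = mat 1 \<and> matrix_inv P ** P = mat 1"
    using assms unfolding invertible_def matrix_inv_def by (rule someI_ex)
  then show "P *v (matrix_inv P *v v) = v" "matrix_inv P *v (P *v v) = v"
    by (simp_all add: matrix_vector_mul_assoc)
qed

text \<open>A Cayley transform of \<open>M\<close>, the matrix whose genericity
  \<open>LCP_generic\<close> demands.\<close>

definition cayley :: "real ^ 'n ^ 'n \<Rightarrow> real ^ 'n ^ 'n" where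
  "cayley M = matrix_inv (M + mat 1) ** (M - mat 1)"

lemma cayley_mult:
  assumes "invertible (M + mat 1)"
  shows "(M + mat 1) *v (cayley M *v v) = (M - mat 1) *v v"
  by (simp only: cayley_def matrix_vector_mul_assoc[symmetric] matrix_inv_mult(1)[OF assms])

lemma LCP_aligned_trio_iff:
  assumes "invertible (M + mat 1)"
  shows "LCP_aligned_trio M l S v \<longleftrightarrow> 0 \<le> l \<and> S \<in> signature_matrices \<and> v \<in> orthant \<and>
    norm v = 1 \<and> pencil (cayley M) S l *v v = 0"
proof -
  have "l *\<^sub>R (((M + mat 1) ** S) *v v) = (M + mat 1) *v (l *\<^sub>R (S *v v))"
    by (simp only: matrix_vector_mul_assoc[symmetric] matrix_vector_mult_scaleR)
  then have "(M - mat 1) *v v = l *\<^sub>R (((M + mat 1) ** S) *v v) \<longleftrightarrow>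
      (M + mat 1) *v (cayley M *v v) = (M + mat 1) *v (l *\<^sub>R (S *v v))"
    by (simp only: cayley_mult[OF assms])
  also have "\<dots> \<longleftrightarrow> cayley M *v v = l *\<^sub>R (S *v v)"
    by (rule inj_eq[OF inj_matrix_vector_mult[OF assms]])
  also have "\<dots> \<longleftrightarrow> pencil (cayley M) S l *v v = 0"
    by (auto simp: pencil_mult)
  finally show ?thesis by (simp add: LCP_aligned_trio_def orthant_def)
qed

lemma aligned_sigs_iff_trio:
  assumes inv: "invertible (M + mat 1)" and l: "0 \<le> l"
  shows "S \<in> aligned_sigs (cayley M) l \<longleftrightarrow> (\<exists>v. LCP_aligned_trio M l S v)"
proof
  assume "S \<in> aligned_sigs (cayley M) l"
  then obtain v where "S \<in> signature_matrices" "v \<in> orthant" "v \<noteq> 0"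
    "pencil (cayley M) S l *v v = 0"
    by (auto simp: aligned_sigs_def aligned_def)
  then have "LCP_aligned_trio M l S ((1 / norm v) *\<^sub>R v)"
    using l by (simp add: LCP_aligned_trio_iff[OF inv] scaleR_orthant matrix_vector_mult_scaleR)
  then show "\<exists>v. LCP_aligned_trio M l S v" ..
next
  assume "\<exists>v. LCP_aligned_trio M l S v"
  then obtain v where v: "S \<in> signature_matrices" "v \<in> orthant" "norm v = 1"
    "pencil (cayley M) S l *v v = 0"
    by (auto simp: LCP_aligned_trio_iff[OF inv])
  then have "v \<noteq> 0" by auto
  with v show "S \<in> aligned_sigs (cayley M) l" by (auto simp: aligned_sigs_def aligned_def)
qed

text \<open>In each coordinate one of \<open>v + S *v v\<close> and \<open>v - S *v v\<close>
  vanishes and the other is twice that of \<open>v\<close>, which gives complementarity and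
  nonnegativity. Multiplying the pencil equation by \<open>M + mat 1\<close> gives the linear
  equation.\<close>

lemma LCP_solution_of_pencil:
  fixes M :: "real ^ 'n ^ 'n"
  assumes inv: "invertible (M + mat 1)" and S: "S \<in> signature_matrices" and v: "v \<in> orthant"
    and eq: "pencil (cayley M) S 1 *v v = 2 *\<^sub>R (matrix_inv (M + mat 1) *v q)"
  shows "LCP_solution q M ((1 / 2) *\<^sub>R (v + S *v v)) ((1 / 2) *\<^sub>R (v - S *v v))"
proof -
  let ?s = "S *v v"
  have s: "?s $ i = v $ i \<or> ?s $ i = - v $ i" for i
    using signature_diag[OF S, of i] by (auto simp: signature_mult_nth[OF S])
  have v0: "0 \<le> v $ i" for i using v by (simp add: orthant_def)
  have "(v + ?s) $ i * (v - ?s) $ i = 0" for i using s[of i] by auto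
  then have "(v + ?s) \<bullet> (v - ?s) = 0"
    unfolding inner_vec_def inner_real_def by (intro sum.neutral ballI)
  then have "((1 / 2) *\<^sub>R (v + ?s)) \<bullet> ((1 / 2) *\<^sub>R (v - ?s)) = 0"
    by (simp only: inner_scaleR_left inner_scaleR_right mult_zero_right)
  moreover have "(1 / 2) *\<^sub>R (v + ?s) = M *v ((1 / 2) *\<^sub>R (v - ?s)) + q"
  proof -
    have "(M + mat 1) *v (?s - cayley M *v v) = 2 *\<^sub>R q"
      using arg_cong[OF eq, of "(*v) (M + mat 1)"]
      by (simp add: pencil_mult matrix_vector_mult_scaleR matrix_inv_mult(1)[OF inv])
    then have "(M + mat 1) *v ?s - (M - mat 1) *v v = 2 *\<^sub>R q"
      by (simp only: matrix_vector_mult_diff_distrib cayley_mult[OF inv])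
    then have "v + ?s = M *v (v - ?s) + 2 *\<^sub>R q"
      by (simp add: matrix_vector_mult_add_rdistrib matrix_vector_mult_diff_rdistrib
          matrix_vector_mult_diff_distrib algebra_simps)
    then show ?thesis by (simp add: matrix_vector_mult_scaleR scaleR_right_distrib)
  qed
  moreover have "0 \<le> ((1 / 2) *\<^sub>R (v + ?s)) $ i" "0 \<le> ((1 / 2) *\<^sub>R (v - ?s)) $ i" for i
    using s[of i] v0[of i] by auto
  ultimately show ?thesis by (simp only: LCP_solution_def) simp
qed

text \<open>For fixed \<open>S\<close> the kernel is a line spanned by a positive vector, so it
  contains only one nonnegative unit vector and pairs can be counted by \<open>S\<close>
  alone.\<close>

lemma LCP_aligned_multiplicity_eq:
  fixes M :: "real ^ 'n ^ 'n"
  assumes inv: "invertible (M + mat 1)" and A: "generic_matrix (cayley M)" and l: "0 \<le> l"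
  shows "LCP_aligned_multiplicity M l = card (aligned_sigs (cayley M) l)"
proof -
  let ?A = "cayley M"
  note trio = LCP_aligned_trio_iff[OF inv]
  have "bij_betw fst {(S, v). LCP_aligned_trio M l S v} (aligned_sigs ?A l)"
    unfolding bij_betw_def
  proof
    have "v = w" if "LCP_aligned_trio M l S v" "LCP_aligned_trio M l S w" for S v w
    proof -
      have S: "S \<in> signature_matrices"
        and v: "v \<in> orthant" "v \<noteq> 0" "pencil ?A S l *v v = 0" "norm v = 1"
        and w: "w \<in> orthant" "pencil ?A S l *v w = 0" "norm w = 1"
        using that unfolding trio by auto
      obtain r where r: "w = r *\<^sub>R v" using generic_kernel[OF A S l v(1-3) w(2)] by blast
      have "0 < v $ i" for i using generic_aligned(2)[OF A S l v(1-3)] .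
      moreover have "0 \<le> r * v $ i" for i using w(1) by (simp add: orthant_def r)
      ultimately have "0 \<le> r" by (metis mult_neg_pos not_less)
      moreover have "\<bar>r\<bar> = 1" using w(3) v(4) by (simp add: r)
      ultimately show ?thesis by (simp add: r)
    qed
    then show "inj_on fst {(S, v). LCP_aligned_trio M l S v}" by (auto simp: inj_on_def)
    show "fst ` {(S, v). LCP_aligned_trio M l S v} = aligned_sigs ?A l"
      using aligned_sigs_iff_trio[OF inv l] by force
  qed
  then show ?thesis unfolding LCP_aligned_multiplicity_def by (rule bij_betw_same_card)
qed

theorem corollary5p8:
  fixes M :: "real ^ 'n ^ 'n"
  assumes "LCP_generic M"
    and "1 \<notin> LCP_aligned_spectrum M"
    and "even (LCP_aligned_count M)"
  shows "Q_matrix M"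
proof -
  let ?A = "cayley M"
  have inv: "invertible (M + mat 1)" and A: "generic_matrix ?A"
    using assms(1) by (simp_all add: LCP_generic_def cayley_def)
  have spec: "l \<in> LCP_aligned_spectrum M \<longleftrightarrow> aligned_sigs ?A l \<noteq> {}" if "0 \<le> l" for l
    using aligned_sigs_iff_trio[OF inv that] by (auto simp: LCP_aligned_spectrum_def)
  have "\<not> aligned ?A S 1" if "S \<in> signature_matrices" for S
    using assms(2) spec[of 1] that by (auto simp: aligned_sigs_def)
  moreover have "{l \<in> LCP_aligned_spectrum M. 1 < l} = aligned_values_gt1 ?A"
    using spec by (auto simp: aligned_values_gt1_def)
  then have "LCP_aligned_count M = (\<Sum>l\<in>aligned_values_gt1 ?A. LCP_aligned_multiplicity M l)"
    by (simp only: LCP_aligned_count_def)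
  then have "LCP_aligned_count M = (\<Sum>l\<in>aligned_values_gt1 ?A. card (aligned_sigs ?A l))"
    by (simp add: LCP_aligned_multiplicity_eq[OF inv A] aligned_values_gt1_def)
  with assms(3) have "even (\<Sum>l\<in>aligned_values_gt1 ?A. card (aligned_sigs ?A l))" by simp
  ultimately have *: "\<exists>S\<in>signature_matrices. \<exists>v\<in>orthant.
      pencil ?A S 1 *v v = 2 *\<^sub>R (matrix_inv (M + mat 1) *v q)" for q
    by (rule pencil_surjective[OF A])
  show ?thesis
    unfolding Q_matrix_def
  proof
    fix q
    obtain S v where "S \<in> signature_matrices" "v \<in> orthant"
      "pencil ?A S 1 *v v = 2 *\<^sub>R (matrix_inv (M + mat 1) *v q)"
      using * by blast
    from LCP_solution_of_pencil[OF inv this] show "\<exists>v w. LCP_solution q M v w" by blast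
  qed
qed

end
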